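(* Let $B_R\subset\mathbb{R}^2$ be the open disc with radius $R>0$ centred at the origin. Then the set of all positive radial eigenvalues $\tau_{0,n}$ of $\mathcal{L}$ on $L^2(B_R)$ and the corresponding radial eigenfunctions $u_{0,n}$ (up to a constant multiple) are given by $$\tau_{0,n}(B_R)=\frac{R^2}{(\mu_{0,n}(B_R))^2},\qquad u_{0,n}(x)=J_0\!\left(\frac{\mu_{0,n}(B_R)}{R}|x|\right),\qquad n\in\mathbb{N},$$ where $\mu_{0,n}(B_R)$ is the $n$-th positive zero of the function $t\mapsto J_0(t)-(\log R)\,t\,J_0'(t)$. In addition, for $R>1$, there exists a unique negative eigenvalue $\tilde\tau_1(B_R)$ of $\mathcal{L}$, and it and the corresponding eigenfunction $\tilde u$ (up to a constant multiple) are given by $$\tilde\tau_1(B_R)=-\frac{R^2}{\mu_0(B_R)^2},\qquad\tilde u(x)=I_0\!\left(\frac{\mu_0(B_R)}{R}|x|\right),$$ where $\mu_0(B_R)$ is the unique positive zero of the function $t\mapsto I_0(t)-(\log R)\,t\,I_0'(t)$.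
   Context: For a bounded open set $\Omega\subset\mathbb{R}^2$, the Logarithmic potential operator $\mathcal{L}$ on $L^2(\Omega)$ is the self-adjoint compact operator $\mathcal{L}u(x)=\frac{1}{2\pi}\int_\Omega \log\frac{1}{|x-y|}\,u(y)\,dy$. An eigenvalue of $\mathcal{L}$ on $B_R$ is called radial if there is a radial eigenfunction corresponding to it. $\mathbb{N}=\{1,2,\dots\}$. $J_0(x)=\sum_{m=0}^\infty\frac{(-1)^m}{(m!)^2}\left(\frac x2\right)^{2m}$ is the Bessel function of order zero and $I_0(x)=\sum_{m=0}^\infty\frac{1}{(m!)^2}\left(\frac x2\right)^{2m}$ is the modified Bessel function of order zero. *)

theory Defs
  imports "HOL-Analysis.Analysis"
begin

definition bessel_J0 :: "real \<Rightarrow> real" where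
  "bessel_J0 x = (\<Sum>m. (-1) ^ m / (fact m)\<^sup>2 * (x / 2) ^ (2 * m))"

definition bessel_I0 :: "real \<Rightarrow> real" where
  "bessel_I0 x = (\<Sum>m. 1 / (fact m)\<^sup>2 * (x / 2) ^ (2 * m))"

text \<open>
  Elements of \<open>L\<^sup>2(\<Omega>)\<close> are represented by real-valued functions. Values outside \<open>\<Omega>\<close> are irrelevant,
  and every notion below is invariant under changing the function on a null set.
\<close>

definition L2 :: "(real ^ 2) set \<Rightarrow> (real ^ 2 \<Rightarrow> real) set" where
  "L2 \<Omega> = {u \<in> borel_measurable (lebesgue_on \<Omega>). integrable (lebesgue_on \<Omega>) (\<lambda>x. (u x)\<^sup>2)}"

text \<open>
  For bounded open \<open>\<Omega>\<close> and \<open>u \<in> L2 \<Omega>\<close> the integrand is integrable for every \<open>x\<close>, since the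
  logarithm is locally square integrable. The convention \<open>ln (1 / 0) = 0\<close> only affects
  the single point \<open>y = x\<close>.
\<close>

definition log_potential :: "(real ^ 2) set \<Rightarrow> (real ^ 2 \<Rightarrow> real) \<Rightarrow> real ^ 2 \<Rightarrow> real" where
  "log_potential \<Omega> u x =
     1 / (2 * pi) * (\<integral>y. ln (1 / norm (x - y)) * u y \<partial>lebesgue_on \<Omega>)"

definition eigenfunction :: "(real ^ 2) set \<Rightarrow> real \<Rightarrow> (real ^ 2 \<Rightarrow> real) \<Rightarrow> bool" where
  "eigenfunction \<Omega> \<tau> u \<longleftrightarrow>
     u \<in> L2 \<Omega> \<and> \<not> (AE x in lebesgue_on \<Omega>. u x = 0) \<and>
     (AE x in lebesgue_on \<Omega>. log_potential \<Omega> u x = \<tau> * u x)"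

definition eigenvalue :: "(real ^ 2) set \<Rightarrow> real \<Rightarrow> bool" where
  "eigenvalue \<Omega> \<tau> \<longleftrightarrow> (\<exists>u. eigenfunction \<Omega> \<tau> u)"

definition radial_on :: "(real ^ 2) set \<Rightarrow> (real ^ 2 \<Rightarrow> real) \<Rightarrow> bool" where
  "radial_on \<Omega> u \<longleftrightarrow> (\<exists>g. AE x in lebesgue_on \<Omega>. u x = g (norm x))"

definition radial_eigenfunction :: "real \<Rightarrow> real \<Rightarrow> (real ^ 2 \<Rightarrow> real) \<Rightarrow> bool" where
  "radial_eigenfunction R \<tau> u \<longleftrightarrow> eigenfunction (ball 0 R) \<tau> u \<and> radial_on (ball 0 R) u"

definition radial_eigenvalue :: "real \<Rightarrow> real \<Rightarrow> bool" where
  "radial_eigenvalue R \<tau> \<longleftrightarrow> (\<exists>u. radial_eigenfunction R \<tau> u)"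

text \<open>
  The \<open>n\<close>-th positive zero, numbered from \<open>n = 1\<close> in increasing order: there are exactly \<open>n\<close> zeros
  in \<open>{0<..t}\<close>, and \<open>t\<close> is one of them.
\<close>

definition is_nth_pos_zero :: "(real \<Rightarrow> real) \<Rightarrow> nat \<Rightarrow> real \<Rightarrow> bool" where
  "is_nth_pos_zero f n t \<longleftrightarrow>
     0 < t \<and> f t = 0 \<and> finite {s. 0 < s \<and> s \<le> t \<and> f s = 0} \<and>
     card {s. 0 < s \<and> s \<le> t \<and> f s = 0} = n"

definition J_boundary :: "real \<Rightarrow> real \<Rightarrow> real" where
  "J_boundary R t = bessel_J0 t - ln R * t * deriv bessel_J0 t"

definition I_boundary :: "real \<Rightarrow> real \<Rightarrow> real" where
  "I_boundary R t = bessel_I0 t - ln R * t * deriv bessel_I0 t"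

definition mu_rad :: "real \<Rightarrow> nat \<Rightarrow> real" where
  "mu_rad R n = (THE t. is_nth_pos_zero (J_boundary R) n t)"

definition mu_neg :: "real \<Rightarrow> real" where
  "mu_neg R = (THE t. 0 < t \<and> I_boundary R t = 0)"

end

theory Submission
  imports Defs "HOL-Complex_Analysis.Cauchy_Integral_Formula"
begin

text \<open>
  The kernel \<open>ln (1 / |x - y|)\<close> is rotation invariant, and the average of \<open>ln |x - y|\<close> over all
  rotations of \<open>y\<close> is \<open>ln (max |x| |y|)\<close>, by the mean value property of the harmonic function
  \<open>ln |1 - z|\<close>. Hence on radial functions the potential becomes a one-dimensional integral operator
  with kernel \<open>ln (max r s)\<close> and weight \<open>s\<close> (\<open>radial_ln_potential\<close>, \<open>distr_norm_disc\<close>).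

  The profiles \<open>bess \<kappa>\<close>, which are \<open>J\<^sub>0\<close> or \<open>I\<^sub>0\<close> of a multiple of the radius, solve
  \<open>(s j')' = \<kappa> s j\<close>. Integrating by parts, the operator maps such a profile to a multiple of itself
  plus a constant, and the constant is the boundary expression \<open>j(R) - ln R \<cdot> R j'(R)\<close>
  (\<open>log_kernel_integral_bess\<close>). So the profile is an eigenfunction exactly at the zeros in the
  theorem. Conversely, a radial eigenfunction satisfies a Volterra equation whose solutions form a
  line (\<open>volterra_zero\<close>), so it is a multiple of such a profile (\<open>log_kernel_solution_bess\<close>).

  For negative eigenvalues all eigenfunctions matter, not only the radial ones. The form
  \<open>\<integral>\<integral> ln (1 / |x - y|) v(x) v(y)\<close> is nonnegative when \<open>v\<close> has mean zero (\<open>ln_form_nonpos\<close>), that is, on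
  a subspace of codimension one. Hence there is at most one negative eigenvalue, and it is simple
  (\<open>negative_eigenfunctions_proportional\<close>); for \<open>R > 1\<close> the radial profile built from \<open>I\<^sub>0\<close> provides it.
  The nonnegativity comes from stereographic projection: it writes \<open>|x - y|\<^sup>2\<close> as
  \<open>A(x) A(y) (1 - K(x, y))\<close> with a Gram kernel \<open>K\<close>, and \<open>- ln (1 - K) = \<Sum> K\<^sup>n / n\<close> is a sum of
  positive semidefinite kernels, while the factors \<open>A\<close> do not see mean-zero functions.

  The zeros of the boundary functions are found from the first order systems satisfied by
  \<open>(j, s j')\<close>: for \<open>I\<^sub>0\<close> the quotient of the two components increases from \<open>0\<close> to \<open>\<infinity>\<close>
  (\<open>clifford_quot_strict_mono\<close>, \<open>clifford_quot_unbounded\<close>); for \<open>J\<^sub>0\<close> the system oscillates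
  (\<open>boundary_unbounded_zeros\<close>) and its zeros are simple, so that they can be enumerated
  (\<open>boundary_finite_zeros\<close>, \<open>mu_rad_zeros\<close>).
\<close>

section \<open>A Bessel-Clifford function\<close>

text \<open>
  The hypergeometric function \<open>0F1(; 1; z)\<close>. Both Bessel functions are this one entire function, at
  the arguments \<open>- x\<^sup>2 / 4\<close> and \<open>x\<^sup>2 / 4\<close>, so one computation serves for both signs of the eigenvalue.
\<close>

definition clifford :: "real \<Rightarrow> real" where
  "clifford z = (\<Sum>m. 1 / (fact m)\<^sup>2 * z ^ m)"

text \<open>
  The image of \<open>clifford\<close> under the Euler operator \<open>z d/dz\<close>. Carrying it as a second unknown turns the
  Bessel equation into a first order system.
\<close>

definition euler_clifford :: "real \<Rightarrow> real" where
  "euler_clifford z = (\<Sum>m. real m / (fact m)\<^sup>2 * z ^ m)"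

lemma summable_clifford: "summable (\<lambda>m. 1 / (fact m)\<^sup>2 * z ^ m :: real)"
proof (rule summable_comparison_test'[where N=0])
  show "summable (\<lambda>m. \<bar>z\<bar> ^ m / fact m)"
    using summable_exp[of "\<bar>z\<bar>"] by (simp add: field_simps)
  show "norm (1 / (fact m)\<^sup>2 * z ^ m) \<le> \<bar>z\<bar> ^ m / fact m" for m
  proof -
    have "1 / (fact m)\<^sup>2 \<le> 1 / (fact m :: real)"
      using fact_ge_1[of m, where 'a=real] by (simp add: power2_eq_square divide_simps)
    then have "1 / (fact m)\<^sup>2 * \<bar>z\<bar> ^ m \<le> 1 / fact m * \<bar>z\<bar> ^ m"
      by (intro mult_right_mono) auto
    then show ?thesis by (simp add: abs_mult power_abs)
  qed
qed

lemma summable_euler_clifford: "summable (\<lambda>m. real m / (fact m)\<^sup>2 * z ^ m :: real)"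
proof (rule summable_comparison_test'[where N=0])
  show "summable (\<lambda>m. \<bar>z\<bar> ^ m / fact m)"
    using summable_exp[of "\<bar>z\<bar>"] by (simp add: field_simps)
  show "norm (real m / (fact m)\<^sup>2 * z ^ m) \<le> \<bar>z\<bar> ^ m / fact m" for m
  proof -
    have "real m \<le> fact m"
      using fact_ge_self[of m] by (metis of_nat_fact of_nat_le_iff)
    then have "real m / (fact m)\<^sup>2 \<le> 1 / fact m"
      by (simp add: power2_eq_square divide_simps)
    then have "real m / (fact m)\<^sup>2 * \<bar>z\<bar> ^ m \<le> 1 / fact m * \<bar>z\<bar> ^ m"
      by (intro mult_right_mono) auto
    then show ?thesis by (simp add: abs_mult power_abs)
  qed
qed

lemma clifford_0 [simp]: "clifford 0 = 1"
  unfolding clifford_def using powser_zero[of "\<lambda>m. 1 / (fact m)\<^sup>2 :: real"] by simp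

lemma euler_clifford_0 [simp]: "euler_clifford 0 = 0"
  unfolding euler_clifford_def using powser_zero[of "\<lambda>m. real m / (fact m)\<^sup>2 :: real"] by simp

lemma has_derivative_euler_clifford:
  "(euler_clifford has_real_derivative clifford z) (at z)"
proof -
  have "diffs (\<lambda>m. real m / (fact m)\<^sup>2) = (\<lambda>m. 1 / (fact m)\<^sup>2 :: real)"
    by (auto simp: diffs_def fun_eq_iff power2_eq_square field_simps simp del: of_nat_Suc)
  then show ?thesis
    using termdiffs_strong_converges_everywhere[OF summable_euler_clifford, of z]
    by (simp only: clifford_def[symmetric] euler_clifford_def[symmetric, abs_def])
qed

lemma has_derivative_clifford_mult:
  "\<exists>D. (clifford has_real_derivative D) (at z) \<and> euler_clifford z = z * D"
proof -
  let ?c = "\<lambda>m. 1 / (fact m)\<^sup>2 :: real"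
  let ?D = "\<Sum>m. diffs ?c m * z ^ m"
  have D: "(clifford has_real_derivative ?D) (at z)"
    using termdiffs_strong_converges_everywhere[OF summable_clifford, of z]
    by (simp add: clifford_def[abs_def])
  have s: "summable (\<lambda>m. diffs ?c m * z ^ m)"
    by (rule termdiff_converges_all[OF summable_clifford])
  have "euler_clifford z = (\<Sum>m. real (Suc m) / (fact (Suc m))\<^sup>2 * z ^ Suc m)"
    unfolding euler_clifford_def using suminf_split_head[OF summable_euler_clifford[of z]] by simp
  also have "\<dots> = (\<Sum>m. z * (diffs ?c m * z ^ m))"
    by (intro suminf_cong) (simp add: diffs_def)
  also have "\<dots> = z * ?D" by (rule suminf_mult[OF s])
  finally show ?thesis using D by blast
qed

lemma has_derivative_clifford:
  assumes "z \<noteq> 0"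
  shows "(clifford has_real_derivative euler_clifford z / z) (at z)"
  using has_derivative_clifford_mult[of z] assms by (metis nonzero_mult_div_cancel_left)

lemma continuous_clifford: "continuous_on S clifford"
  by (intro continuous_at_imp_continuous_on ballI) (use has_derivative_clifford_mult DERIV_isCont in blast)

lemma continuous_euler_clifford: "continuous_on S euler_clifford"
  by (intro continuous_at_imp_continuous_on ballI) (use has_derivative_euler_clifford DERIV_isCont in blast)

lemma bessel_J0_clifford: "bessel_J0 x = clifford (- (x\<^sup>2 / 4))"
proof -
  have "(-1) ^ m / (fact m)\<^sup>2 * (x / 2) ^ (2 * m) = 1 / (fact m)\<^sup>2 * (- (x\<^sup>2 / 4)) ^ m" for m
    unfolding power_mult power_minus[of "x\<^sup>2 / 4"] by (simp add: power_divide)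
  then show ?thesis by (simp only: bessel_J0_def clifford_def)
qed

lemma bessel_I0_clifford: "bessel_I0 x = clifford (x\<^sup>2 / 4)"
  by (simp add: bessel_I0_def clifford_def power_mult power_divide)

text \<open>
  For \<open>\<kappa> = - a\<^sup>2\<close> this is \<open>J\<^sub>0(a s)\<close>, for \<open>\<kappa> = a\<^sup>2\<close> it is \<open>I\<^sub>0(a s)\<close>. It is the radial solution of
  \<open>\<Delta> u = \<kappa> u\<close>, and \<open>bess_flux \<kappa> s\<close> is \<open>s\<close> times its derivative.
\<close>

definition bess :: "real \<Rightarrow> real \<Rightarrow> real" where
  "bess \<kappa> s = clifford (\<kappa> * s\<^sup>2 / 4)"

definition bess_flux :: "real \<Rightarrow> real \<Rightarrow> real" where
  "bess_flux \<kappa> s = 2 * euler_clifford (\<kappa> * s\<^sup>2 / 4)"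

lemma bess_0 [simp]: "bess \<kappa> 0 = 1" "bess_flux \<kappa> 0 = 0"
  by (auto simp: bess_def bess_flux_def)

lemma bess_deriv_mult: "\<exists>D. (bess \<kappa> has_real_derivative D) (at s) \<and> bess_flux \<kappa> s = s * D"
proof -
  obtain D where D: "(clifford has_real_derivative D) (at (\<kappa> * s\<^sup>2 / 4))"
      "euler_clifford (\<kappa> * s\<^sup>2 / 4) = \<kappa> * s\<^sup>2 / 4 * D"
    using has_derivative_clifford_mult by blast
  have "(bess \<kappa> has_real_derivative D * (\<kappa> * s / 2)) (at s)"
    unfolding bess_def[abs_def]
    by (rule DERIV_chain2[where f=clifford and g="\<lambda>s. \<kappa> * s\<^sup>2 / 4", OF D(1)]) (auto intro!: derivative_eq_intros)
  moreover have "bess_flux \<kappa> s = s * (D * (\<kappa> * s / 2))"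
    unfolding bess_flux_def D(2) by (simp add: power2_eq_square)
  ultimately show ?thesis by blast
qed

lemma bess_deriv: "s \<noteq> 0 \<Longrightarrow> (bess \<kappa> has_real_derivative bess_flux \<kappa> s / s) (at s)"
  using bess_deriv_mult[of \<kappa> s] by (metis nonzero_mult_div_cancel_left)

lemma bess_flux_deriv: "(bess_flux \<kappa> has_real_derivative \<kappa> * s * bess \<kappa> s) (at s)"
proof -
  have "((\<lambda>s. 2 * euler_clifford (\<kappa> * s\<^sup>2 / 4)) has_real_derivative
      2 * (clifford (\<kappa> * s\<^sup>2 / 4) * (\<kappa> * s / 2))) (at s)"
    by (intro DERIV_cmult DERIV_chain2[where f=euler_clifford, OF has_derivative_euler_clifford])
      (auto intro!: derivative_eq_intros)
  then show ?thesis
    unfolding bess_flux_def[abs_def] bess_def by (simp add: mult_ac)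
qed

lemma continuous_bess: "continuous_on S (bess \<kappa>)"
  by (intro continuous_at_imp_continuous_on ballI) (use bess_deriv_mult DERIV_isCont in blast)

lemma bess_measurable [measurable]: "bess \<kappa> \<in> borel_measurable borel"
  by (rule borel_measurable_continuous_onI[OF continuous_bess])

lemma bess_bounded: "\<exists>B. \<forall>s\<in>{0..R}. \<bar>bess \<kappa> s\<bar> \<le> B"
proof -
  have "bounded (bess \<kappa> ` {0..R})"
    by (intro compact_imp_bounded compact_continuous_image continuous_bess) auto
  then show ?thesis unfolding bounded_iff by fastforce
qed

lemma bessel_J0_eq_bess: "bessel_J0 = bess (-1)"
  by (simp add: fun_eq_iff bess_def bessel_J0_clifford)

lemma bessel_I0_eq_bess: "bessel_I0 = bess 1"
  by (simp add: fun_eq_iff bess_def bessel_I0_clifford)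

lemma J_boundary_eq: "J_boundary R t = bess (-1) t - ln R * bess_flux (-1) t"
proof -
  obtain D where D: "(bess (-1) has_real_derivative D) (at t)" "bess_flux (-1) t = t * D"
    using bess_deriv_mult by blast
  then show ?thesis unfolding J_boundary_def bessel_J0_eq_bess by (simp add: DERIV_imp_deriv)
qed

lemma I_boundary_eq: "I_boundary R t = bess 1 t - ln R * bess_flux 1 t"
proof -
  obtain D where D: "(bess 1 has_real_derivative D) (at t)" "bess_flux 1 t = t * D"
    using bess_deriv_mult by blast
  then show ?thesis unfolding I_boundary_def bessel_I0_eq_bess by (simp add: DERIV_imp_deriv)
qed

lemma bess_scale: "bess (c * \<mu>\<^sup>2) s = bess c (\<mu> * s)" "bess_flux (c * \<mu>\<^sup>2) s = bess_flux c (\<mu> * s)"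
  by (auto simp: bess_def bess_flux_def power_mult_distrib mult_ac)

section \<open>Zeros of the boundary functions\<close>

lemma clifford_lower_bounds: assumes "z \<ge> 0" shows "clifford z \<ge> 1" "euler_clifford z \<ge> z"
proof -
  have "(\<Sum>m<1. 1 / (fact m)\<^sup>2 * z ^ m) \<le> clifford z"
    unfolding clifford_def using assms by (intro sum_le_suminf summable_clifford) auto
  then show "clifford z \<ge> 1" by simp
  have "(\<Sum>m<2. real m / (fact m)\<^sup>2 * z ^ m) \<le> euler_clifford z"
    unfolding euler_clifford_def using assms by (intro sum_le_suminf summable_euler_clifford) auto
  then show "euler_clifford z \<ge> z" by (simp add: numeral_2_eq_2)
qed

text \<open>
  The difference of the two sides has derivative \<open>(clifford z)\<^sup>2\<close> and vanishes at the origin. In terms of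
  Bessel functions this is \<open>I\<^sub>1 < I\<^sub>0\<close>.
\<close>

lemma euler_clifford_sq_less:
  assumes "z > 0"
  shows "(euler_clifford z)\<^sup>2 < z * (clifford z)\<^sup>2"
proof -
  let ?g = "\<lambda>z. z * (clifford z)\<^sup>2 - (euler_clifford z)\<^sup>2"
  have "?g 0 < ?g z"
  proof (rule DERIV_pos_imp_increasing_open[OF assms])
    fix x :: real assume x: "0 < x" "x < z"
    have "(?g has_real_derivative (clifford x)\<^sup>2) (at x)"
      using x by (auto intro!: derivative_eq_intros has_derivative_clifford has_derivative_euler_clifford
          simp: power2_eq_square field_simps)
    moreover have "(clifford x)\<^sup>2 > 0" using clifford_lower_bounds(1)[of x] x by auto
    ultimately show "\<exists>y. (?g has_real_derivative y) (at x) \<and> 0 < y" by blast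
  next
    show "continuous_on {0..z} ?g"
      by (intro continuous_intros continuous_clifford continuous_euler_clifford)
  qed
  then show ?thesis by simp
qed

text \<open>
  The logarithmic derivative of \<open>I\<^sub>0\<close> in disguise; the zeros of \<open>I_boundary R\<close> are the points where it
  takes the value \<open>1 / (2 ln R)\<close>. It solves the Riccati equation of \<open>clifford_quot_deriv\<close>.
\<close>

definition clifford_quot :: "real \<Rightarrow> real" where
  "clifford_quot z = euler_clifford z / clifford z"

lemma clifford_quot_deriv:
  assumes "z > 0"
  shows "(clifford_quot has_real_derivative 1 - (clifford_quot z)\<^sup>2 / z) (at z)"
proof -
  have "clifford z \<noteq> 0" using clifford_lower_bounds(1)[of z] assms by auto
  then show ?thesis
    unfolding clifford_quot_def[abs_def] using assms
    by (auto intro!: derivative_eq_intros has_derivative_clifford has_derivative_euler_clifford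
        simp: power2_eq_square field_simps)
qed

lemma clifford_quot_strict_mono:
  assumes "0 \<le> a" "a < b"
  shows "clifford_quot a < clifford_quot b"
proof (rule DERIV_pos_imp_increasing_open[OF assms(2)])
  fix x assume x: "a < x" "x < b"
  then have x0: "x > 0" using assms by simp
  have c: "clifford x > 0" using clifford_lower_bounds(1)[of x] x0 by auto
  have "(clifford_quot x)\<^sup>2 / x < 1"
    using euler_clifford_sq_less[OF x0] x0 c by (simp add: clifford_quot_def power_divide divide_simps mult.commute)
  then show "\<exists>y. (clifford_quot has_real_derivative y) (at x) \<and> 0 < y"
    using clifford_quot_deriv[OF x0] by auto
next
  have "clifford x \<noteq> 0" if "x \<in> {a..b}" for x
    using clifford_lower_bounds(1)[of x] that assms by auto
  then show "continuous_on {a..b} clifford_quot"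
    unfolding clifford_quot_def[abs_def]
    by (intro continuous_intros continuous_clifford continuous_euler_clifford) auto
qed

text \<open>
  If \<open>K\<close> bounded the quotient, the Riccati equation would force slope at least \<open>1/2\<close> beyond \<open>2 K\<^sup>2\<close>.
\<close>

lemma clifford_quot_unbounded: "\<exists>z>0. clifford_quot z > K"
proof (rule ccontr)
  assume "\<not> ?thesis"
  then have le: "clifford_quot z \<le> K" if "z > 0" for z using that by force
  have pos: "clifford_quot z \<ge> 0" if "z > 0" for z
    using clifford_lower_bounds[of z] that by (auto simp: clifford_quot_def)
  have K: "K \<ge> 0" using le[of 1] pos[of 1] by simp
  define a where "a = 2 * K\<^sup>2 + 1"
  \<comment> \<open>An interval long enough for slope \<open>1/2\<close> to gain more than \<open>K\<close>.\<close>
  define b where "b = a + 2 * K + 1"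
  have a: "a > 0" "a < b" using K by (auto simp: a_def b_def add_nonneg_pos)
  have "\<exists>z. a < z \<and> z < b \<and> clifford_quot b - clifford_quot a = (b - a) * (1 - (clifford_quot z)\<^sup>2 / z)"
    using a by (intro MVT2 clifford_quot_deriv) auto
  then obtain z where z: "a < z" "z < b"
    "clifford_quot b - clifford_quot a = (b - a) * (1 - (clifford_quot z)\<^sup>2 / z)" by blast
  have "(clifford_quot z)\<^sup>2 \<le> K\<^sup>2" using le[of z] pos[of z] z a by (intro power_mono) auto
  also have "\<dots> \<le> z / 2" using z by (simp add: a_def)
  finally have "(clifford_quot z)\<^sup>2 / z \<le> 1 / 2" using z a by (simp add: field_simps)
  then have "(b - a) * (1 / 2) \<le> clifford_quot b - clifford_quot a"
    unfolding z(3) using a by (intro mult_left_mono) auto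
  moreover have "clifford_quot b - clifford_quot a \<le> K" using le[of b] pos[of a] a by auto
  ultimately show False by (simp add: b_def)
qed

lemma I_boundary_unique_zero:
  assumes "R > 1"
  shows "\<exists>!t. 0 < t \<and> I_boundary R t = 0"
proof -
  have L: "ln R > 0" using assms by simp
  have eq: "I_boundary R t = 0 \<longleftrightarrow> clifford_quot (t\<^sup>2 / 4) = 1 / (2 * ln R)" for t
    using clifford_lower_bounds(1)[of "t\<^sup>2/4"] L
    by (auto simp: I_boundary_eq bess_def bess_flux_def clifford_quot_def field_simps)
  obtain b where b: "b > 0" "clifford_quot b > 1 / (2 * ln R)" using clifford_quot_unbounded by blast
  have "continuous_on {0..b} clifford_quot"
    unfolding clifford_quot_def[abs_def] using clifford_lower_bounds(1)
    by (intro continuous_intros continuous_clifford continuous_euler_clifford) force+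
  moreover have "clifford_quot 0 = 0" by (simp add: clifford_quot_def)
  ultimately obtain z where z: "0 \<le> z" "z \<le> b" "clifford_quot z = 1 / (2 * ln R)"
    using IVT'[of clifford_quot 0 "1 / (2 * ln R)" b] b L by auto
  have "z \<noteq> 0" using z L by (auto simp: clifford_quot_def)
  then have "0 < 2 * sqrt z \<and> I_boundary R (2 * sqrt z) = 0"
    unfolding eq using z by (simp add: power_mult_distrib)
  moreover have "s = t" if "0 < s \<and> I_boundary R s = 0" "0 < t \<and> I_boundary R t = 0" for s t
  proof -
    have "clifford_quot (s\<^sup>2/4) = clifford_quot (t\<^sup>2/4)" using that eq by simp
    then have "s\<^sup>2/4 = t\<^sup>2/4"
      using clifford_quot_strict_mono[of "s\<^sup>2/4" "t\<^sup>2/4"] clifford_quot_strict_mono[of "t\<^sup>2/4" "s\<^sup>2/4"]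
      by (metis less_irrefl linorder_neqE_linordered_idom zero_le_divide_iff zero_le_numeral zero_le_power2)
    then show ?thesis using that by (simp add: power2_eq_iff)
  qed
  ultimately show ?thesis by blast
qed

text \<open>
  \<open>osc\<close> and \<open>osc_flux\<close> are \<open>J\<^sub>0\<close> and \<open>- t J\<^sub>0'/2\<close> in the variable \<open>x = t\<^sup>2 / 4\<close>. They satisfy
  \<open>osc_flux' = osc\<close> and \<open>osc' = - osc_flux / x\<close>.
\<close>

definition osc :: "real \<Rightarrow> real" where "osc x = clifford (- x)"
definition osc_flux :: "real \<Rightarrow> real" where "osc_flux x = - euler_clifford (- x)"

lemma osc_0 [simp]: "osc 0 = 1" "osc_flux 0 = 0" by (auto simp: osc_def osc_flux_def)

lemma osc_deriv: "x \<noteq> 0 \<Longrightarrow> (osc has_real_derivative - osc_flux x / x) (at x)"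
  unfolding osc_def[abs_def] osc_flux_def
  by (rule DERIV_cong, rule DERIV_chain2[where f=clifford and g=uminus, OF has_derivative_clifford])
    (auto intro!: derivative_eq_intros)

lemma osc_flux_deriv: "(osc_flux has_real_derivative osc x) (at x)"
  unfolding osc_def osc_flux_def[abs_def]
  by (rule DERIV_cong, rule DERIV_minus, rule DERIV_chain2[where f=euler_clifford and g=uminus, OF has_derivative_euler_clifford])
    (auto intro!: derivative_eq_intros)

lemma continuous_osc: "continuous_on S osc" "continuous_on S osc_flux"
  unfolding osc_def[abs_def] osc_flux_def[abs_def]
  by (intro continuous_intros continuous_on_compose2[OF continuous_clifford] continuous_on_compose2[OF continuous_euler_clifford]; force)+

text \<open>
  The expression has derivative \<open>(osc x)\<^sup>2\<close>, so it never decreases, and it is positive near the origin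
  because \<open>osc 0 = 1\<close>. Consequently the two functions have no common zero.
\<close>

lemma osc_energy_pos:
  assumes "x > 0"
  shows "x * (osc x)\<^sup>2 + (osc_flux x)\<^sup>2 > 0"
proof -
  let ?g = "\<lambda>x. x * (osc x)\<^sup>2 + (osc_flux x)\<^sup>2"
  have d: "(?g has_real_derivative (osc x)\<^sup>2) (at x)" if "x > 0" for x
    using that by (auto intro!: derivative_eq_intros osc_deriv osc_flux_deriv
          simp: power2_eq_square field_simps)
  have mono: "?g a \<le> ?g b" if "0 \<le> a" "a \<le> b" for a b
  proof (cases "a = b")
    case False
    then show ?thesis using that
      by (intro DERIV_nonneg_imp_increasing_open[of a b ?g])
        (auto intro!: exI[of _ "(osc _)\<^sup>2"] d continuous_intros continuous_osc)
  qed auto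
  obtain \<delta> where \<delta>: "\<delta> > 0" "\<And>y. \<bar>y\<bar> < \<delta> \<Longrightarrow> \<bar>osc y - 1\<bar> < 1"
    using continuous_osc(1)[of UNIV, unfolded continuous_on_iff, rule_format, of 0 1]
    by (auto simp: dist_real_def)
  define y where "y = min x (\<delta> / 2)"
  have y: "0 < y" "y \<le> x" "\<bar>y\<bar> < \<delta>" using assms \<delta>(1) by (auto simp: y_def)
  moreover have "osc y > 0" using \<delta>(2)[OF y(3)] by linarith
  ultimately have "0 < ?g y" by (intro add_pos_nonneg mult_pos_pos) auto
  also have "\<dots> \<le> ?g x" using y by (intro mono) auto
  finally show ?thesis .
qed

text \<open>
  Without zeros \<open>osc\<close> would eventually keep one sign, say positive, so the flux would increase. If the
  flux becomes positive, \<open>osc\<close> decreases at least like a multiple of \<open>- ln x\<close>; if it stays nonpositive,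
  \<open>osc\<close> increases and the flux grows at least linearly. Both are contradictory.
\<close>

lemma osc_unbounded_zeros: "\<exists>x>X. osc x = 0"
proof (rule ccontr)
  assume neg: "\<not> ?thesis"
  define a where "a = max X 0 + 1"
  have a: "a > X" "a > 0" by (auto simp: a_def)
  have nz: "osc x \<noteq> 0" if "x \<ge> a" for x using neg that a by force
  have sgn: "osc x * osc a > 0" if "x \<ge> a" for x
  proof (rule ccontr)
    assume "\<not> ?thesis"
    then have "osc x * osc a \<le> 0" by simp
    then have "(osc a \<le> 0 \<and> 0 \<le> osc x) \<or> (osc x \<le> 0 \<and> 0 \<le> osc a)"
      by (auto simp: mult_le_0_iff)
    then have "\<exists>y\<ge>a. y \<le> x \<and> osc y = 0"
      using IVT'[of osc a 0 x] IVT2'[of osc x 0 a] that continuous_osc by auto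
    then show False using nz by blast
  qed
  \<comment> \<open>The system is linear, so a global sign makes \<open>osc\<close> positive beyond \<open>a\<close>.\<close>
  define \<sigma> where "\<sigma> = sgn (osc a)"
  define e where "e = (\<lambda>x. \<sigma> * osc x)"
  define w where "w = (\<lambda>x. \<sigma> * osc_flux x)"
  have epos: "e x > 0" if "x \<ge> a" for x
    using sgn[OF that] nz[of a] by (auto simp: e_def \<sigma>_def sgn_if zero_less_mult_iff split: if_splits)
  have de: "(e has_real_derivative - w x / x) (at x)" if "x \<ge> a" for x
    unfolding e_def w_def using that a by (auto intro!: derivative_eq_intros osc_deriv)
  have dw: "(w has_real_derivative e x) (at x)" for x
    unfolding e_def w_def by (auto intro!: derivative_eq_intros osc_flux_deriv)
  have wmono: "w x \<le> w y" if "a \<le> x" "x \<le> y" for x y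
    using that dw epos by (intro DERIV_nonneg_imp_nondecreasing[OF that(2)]) (meson less_imp_le order_trans)
  show False
  proof (cases "\<exists>b\<ge>a. w b > 0")
    case True
    then obtain b where b: "b \<ge> a" "w b > 0" by blast
    let ?g = "\<lambda>x. e x + w b * ln x"
    \<comment> \<open>Here the bound \<open>e y \<le> e b - w b * ln (y / b)\<close> has reached \<open>- w b\<close>.\<close>
    define y where "y = b * exp (e b / w b + 1)"
    have hby: "b \<le> y" using b a epos[OF b(1)] by (auto simp: y_def)
    have "?g y \<le> ?g b"
    proof (rule DERIV_nonpos_imp_nonincreasing[OF hby])
      fix x assume x: "b \<le> x" "x \<le> y"
      have "(?g has_real_derivative - w x / x + w b / x) (at x)"
        using x b a by (auto intro!: derivative_eq_intros de)
      moreover have "- w x / x + w b / x \<le> 0"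
        using wmono[of b x] x b a by (simp add: field_simps)
      ultimately show "\<exists>y. (?g has_real_derivative y) (at x) \<and> y \<le> 0" by blast
    qed
    moreover have "w b * ln y = w b * ln b + e b + w b"
      using b a by (simp add: y_def ln_mult algebra_simps)
    ultimately have "e y \<le> - w b" by simp
    then show False using epos[of y] hby b by simp
  next
    case False
    then have wn: "w x \<le> 0" if "x \<ge> a" for x using that by force
    have emono: "e a \<le> e x" if "a \<le> x" for x
    proof (rule DERIV_nonneg_imp_nondecreasing[OF that])
      fix y assume y: "a \<le> y" "y \<le> x"
      then have "- w y / y \<ge> 0" using wn[of y] a by (simp add: divide_nonpos_pos)
      then show "\<exists>d. (e has_real_derivative d) (at y) \<and> 0 \<le> d" using de[OF y(1)] by blast
    qed
    define y where "y = a + (1 - w a) / e a"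
    have ea: "e a > 0" using epos by simp
    have ay: "a \<le> y" using ea wn[of a] by (simp add: y_def)
    let ?g = "\<lambda>x. w x - e a * x"
    have "?g a \<le> ?g y"
    proof (rule DERIV_nonneg_imp_nondecreasing[OF ay])
      fix x assume x: "a \<le> x" "x \<le> y"
      have "(?g has_real_derivative e x - e a) (at x)"
        by (auto intro!: derivative_eq_intros dw)
      then show "\<exists>d. (?g has_real_derivative d) (at x) \<and> 0 \<le> d" using emono[OF x(1)] by force
    qed
    moreover have "e a * y = e a * a + 1 - w a" using ea by (simp add: y_def field_simps)
    ultimately have "w y \<ge> 1" by simp
    then show False using wn[OF ay] by simp
  qed
qed

lemma osc_flux_unbounded_zeros: "\<exists>x>X. osc_flux x = 0"
proof -
  obtain a where a: "a > max X 0" "osc a = 0" using osc_unbounded_zeros by blast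
  obtain b where b: "b > a" "osc b = 0" using osc_unbounded_zeros by blast
  have "\<exists>z. a < z \<and> z < b \<and> osc b - osc a = (b - a) * (- osc_flux z / z)"
    using a b by (intro MVT2 osc_deriv) auto
  then obtain z where z: "a < z" "osc b - osc a = (b - a) * (- osc_flux z / z)" by blast
  then have "osc_flux z = 0" using a b by simp
  then show ?thesis using a z(1) by (intro exI[of _ z]) simp
qed

text \<open>
  Rolle's theorem for \<open>osc_flux x * exp (c x)\<close>, whose derivative is the boundary expression times the
  exponential.
\<close>

lemma boundary_unbounded_zeros: "\<exists>x>X. osc x + c * osc_flux x = 0"
proof -
  obtain a where a: "a > X" "osc_flux a = 0" using osc_flux_unbounded_zeros by blast
  obtain b where b: "b > a" "osc_flux b = 0" using osc_flux_unbounded_zeros by blast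
  let ?g = "\<lambda>x. osc_flux x * exp (c * x)"
  have d: "(?g has_real_derivative (osc x + c * osc_flux x) * exp (c * x)) (at x)" for x
    by (auto intro!: derivative_eq_intros osc_flux_deriv simp: algebra_simps)
  have "\<exists>z. a < z \<and> z < b \<and> ?g b - ?g a = (b - a) * ((osc z + c * osc_flux z) * exp (c * z))"
    using a b by (intro MVT2 d)
  then obtain z where z: "a < z" "?g b - ?g a = (b - a) * ((osc z + c * osc_flux z) * exp (c * z))" by blast
  then have "osc z + c * osc_flux z = 0" using a b by simp
  then show ?thesis using a z(1) by (intro exI[of _ z]) simp
qed

text \<open>
  Every zero is simple: if the expression and its derivative both vanished at \<open>x\<close>, then so would
  \<open>osc_flux x * (1 + c\<^sup>2 x)\<close>, and then \<open>osc x\<close>, against the energy bound. So zeros are isolated.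
\<close>

lemma boundary_finite_zeros: "finite {x. 0 \<le> x \<and> x \<le> b \<and> osc x + c * osc_flux x = 0}"
proof -
  let ?h = "\<lambda>x. osc x + c * osc_flux x"
  let ?Z = "{x. 0 \<le> x \<and> ?h x = 0}"
  have cont: "continuous_on UNIV ?h" by (intro continuous_intros continuous_osc)
  have ch: "isCont ?h x" for x using cont by (simp add: continuous_on_eq_continuous_at)
  have iso: "eventually (\<lambda>y. ?h y \<noteq> 0) (at x)" if "x \<ge> 0" for x
  proof (cases "?h x = 0")
    case False
    then show ?thesis using tendsto_imp_eventually_ne[OF ch[of x, unfolded isCont_def]] by blast
  next
    case True
    then have x: "x > 0" using that by (cases "x = 0") auto
    let ?D = "- osc_flux x / x + c * osc x"
    have D: "(?h has_real_derivative ?D) (at x)"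
      using x by (auto intro!: derivative_eq_intros osc_deriv osc_flux_deriv)
    have "?D \<noteq> 0"
    proof
      assume "?D = 0"
      moreover have e: "osc x = - c * osc_flux x" using True by simp
      ultimately have "osc_flux x * (1 + c\<^sup>2 * x) = 0" using x by (simp add: field_simps power2_eq_square)
      moreover have "1 + c\<^sup>2 * x > 0" using x by (simp add: add_pos_nonneg)
      ultimately have "osc_flux x = 0" by auto
      then show False using e osc_energy_pos[OF x] by simp
    qed
    moreover have "((\<lambda>y. (?h y - ?h x) / (y - x)) \<longlongrightarrow> ?D) (at x)"
      using D by (simp add: has_field_derivative_iff)
    ultimately have "eventually (\<lambda>y. (?h y - ?h x) / (y - x) \<noteq> 0) (at x)"
      by (rule tendsto_imp_eventually_ne[rotated])
    then show ?thesis by eventually_elim (use True in auto)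
  qed
  have "finite ({0..b} \<inter> ?Z)"
  proof (rule finite_not_islimpt_in_compact)
    fix x assume "x \<in> {0..b}"
    then have "eventually (\<lambda>y. y \<notin> ?Z) (at x)" using iso[of x] by (auto elim: eventually_mono)
    then show "\<not> x islimpt ?Z" by (simp add: islimpt_iff_eventually)
  qed auto
  also have "{0..b} \<inter> ?Z = {x. 0 \<le> x \<and> x \<le> b \<and> ?h x = 0}" by auto
  finally show ?thesis .
qed

lemma J_boundary_osc: "J_boundary R t = osc (t\<^sup>2/4) + 2 * ln R * osc_flux (t\<^sup>2/4)"
  by (simp add: J_boundary_eq bess_def bess_flux_def osc_def osc_flux_def)

lemma J_boundary_unbounded_zeros: "\<exists>t>T. t > 0 \<and> J_boundary R t = 0"
proof -
  obtain x where x: "x > (max T 0)\<^sup>2 / 4" "osc x + 2 * ln R * osc_flux x = 0"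
    using boundary_unbounded_zeros by blast
  have x0: "x \<ge> 0" using x(1) by (smt (verit) zero_le_divide_iff zero_le_power2)
  have "J_boundary R (2 * sqrt x) = 0" using x x0 by (simp add: J_boundary_osc power_mult_distrib)
  moreover have "max T 0 < 2 * sqrt x"
    using x x0 real_less_rsqrt[of "max T 0 / 2" x] by (simp add: power_divide)
  ultimately show ?thesis by (intro exI[of _ "2 * sqrt x"]) auto
qed

lemma J_boundary_finite_zeros: "finite {s. 0 < s \<and> s \<le> t \<and> J_boundary R s = 0}"
proof -
  let ?Z = "{x. 0 \<le> x \<and> x \<le> t\<^sup>2/4 \<and> osc x + 2 * ln R * osc_flux x = 0}"
  have "finite ((\<lambda>x. 2 * sqrt x) ` ?Z)" by (intro finite_imageI boundary_finite_zeros)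
  moreover have "{s. 0 < s \<and> s \<le> t \<and> J_boundary R s = 0} \<subseteq> (\<lambda>x. 2 * sqrt x) ` ?Z"
  proof
    fix s assume "s \<in> {s. 0 < s \<and> s \<le> t \<and> J_boundary R s = 0}"
    then have "s\<^sup>2/4 \<in> ?Z" "s = 2 * sqrt (s\<^sup>2/4)"
      by (auto simp: J_boundary_osc power_mono real_sqrt_divide)
    then show "s \<in> (\<lambda>x. 2 * sqrt x) ` ?Z" by blast
  qed
  ultimately show ?thesis by (rule finite_subset[rotated])
qed

lemma is_nth_pos_zero_unique:
  assumes "is_nth_pos_zero f n s" "is_nth_pos_zero f n t"
  shows "s = t"
proof -
  have False if "is_nth_pos_zero f n a" "is_nth_pos_zero f n b" "a < b" for a b
  proof -
    have "{s. 0 < s \<and> s \<le> a \<and> f s = 0} \<subseteq> {s. 0 < s \<and> s \<le> b \<and> f s = 0}"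
      using that(3) by auto
    moreover have "b \<in> {s. 0 < s \<and> s \<le> b \<and> f s = 0}" "b \<notin> {s. 0 < s \<and> s \<le> a \<and> f s = 0}"
      using that unfolding is_nth_pos_zero_def by auto
    ultimately have "card {s. 0 < s \<and> s \<le> a \<and> f s = 0} < card {s. 0 < s \<and> s \<le> b \<and> f s = 0}"
      using that(2) by (intro psubset_card_mono) (auto simp: is_nth_pos_zero_def)
    then show False using that(1,2) by (simp add: is_nth_pos_zero_def)
  qed
  then show ?thesis using assms by (meson linorder_neqE_linordered_idom)
qed

lemma is_nth_pos_zero_card:
  assumes "finite {s. 0 < s \<and> s \<le> t \<and> f s = 0}" "0 < t" "f t = 0"
  shows "\<exists>n\<ge>1. is_nth_pos_zero f n t"
proof -
  have "t \<in> {s. 0 < s \<and> s \<le> t \<and> f s = 0}" using assms by simp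
  then have "card {s. 0 < s \<and> s \<le> t \<and> f s = 0} \<ge> 1"
    using assms(1) card_gt_0_iff by (metis One_nat_def Suc_leI empty_iff)
  then show ?thesis using assms unfolding is_nth_pos_zero_def by blast
qed

text \<open>
  The next zero after \<open>a\<close> is a minimum over the finitely many zeros up to some later one; it adds one
  element to the set that is counted in \<open>is_nth_pos_zero\<close>.
\<close>

lemma ex_nth_pos_zero:
  fixes f :: "real \<Rightarrow> real"
  assumes fin: "\<And>t. finite {s. 0 < s \<and> s \<le> t \<and> f s = 0}"
    and unb: "\<And>T. \<exists>t>T. t > 0 \<and> f t = 0"
  shows "\<exists>t. is_nth_pos_zero f (Suc n) t"
proof -
  have step: "\<exists>t>a. f t = 0 \<and> {s. 0 < s \<and> s \<le> t \<and> f s = 0} = insert t {s. 0 < s \<and> s \<le> a \<and> f s = 0}"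
    if "a \<ge> 0" for a
  proof -
    obtain b where b: "b > a" "f b = 0" using unb by blast
    let ?S = "{s. a < s \<and> s \<le> b \<and> f s = 0}"
    have fS: "finite ?S" by (rule finite_subset[OF _ fin[of b]]) (use that in auto)
    define m where "m = Min ?S"
    have "m \<in> ?S" unfolding m_def using b by (intro Min_in fS) auto
    moreover have "m \<le> s" if "s \<in> ?S" for s unfolding m_def using fS that by simp
    then have "a < s \<Longrightarrow> s \<le> m \<Longrightarrow> f s = 0 \<Longrightarrow> s = m" for s
      using \<open>m \<in> ?S\<close> by force
    ultimately have "{s. 0 < s \<and> s \<le> m \<and> f s = 0} = insert m {s. 0 < s \<and> s \<le> a \<and> f s = 0}"
      using that by (auto; meson not_le_imp_less)
    then show ?thesis using \<open>m \<in> ?S\<close> by blast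
  qed
  show ?thesis
  proof (induction n)
    case 0
    obtain t where t: "t > 0" "f t = 0" "{s. 0 < s \<and> s \<le> t \<and> f s = 0} = insert t {s. 0 < s \<and> s \<le> 0 \<and> f s = 0}"
      using step[of 0] by auto
    have e: "{s. 0 < s \<and> s \<le> (0::real) \<and> f s = 0} = {}" by auto
    have "is_nth_pos_zero f 1 t" unfolding is_nth_pos_zero_def t(3) e using t by simp
    then show ?case by auto
  next
    case (Suc n)
    then obtain a where a: "is_nth_pos_zero f (Suc n) a" by blast
    obtain t where t: "t > a" "f t = 0" "{s. 0 < s \<and> s \<le> t \<and> f s = 0} = insert t {s. 0 < s \<and> s \<le> a \<and> f s = 0}"
      using step[of a] a by (auto simp: is_nth_pos_zero_def)
    have "is_nth_pos_zero f (Suc (Suc n)) t"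
      unfolding is_nth_pos_zero_def t(3) using a t(1,2) fin by (auto simp: is_nth_pos_zero_def card_insert_if)
    then show ?case by blast
  qed
qed

lemma J_boundary_nth_zero:
  assumes "n \<ge> 1"
  shows "\<exists>!t. is_nth_pos_zero (J_boundary R) n t"
proof -
  obtain m where "n = Suc m" using assms by (cases n) auto
  then show ?thesis
    using ex_nth_pos_zero[of "J_boundary R" m] J_boundary_finite_zeros J_boundary_unbounded_zeros
      is_nth_pos_zero_unique by blast
qed

lemma mu_rad_zeros: "mu_rad R ` {1..} = {t. 0 < t \<and> J_boundary R t = 0}"
proof (intro equalityI subsetI)
  fix t assume "t \<in> mu_rad R ` {1..}"
  then obtain n where n: "n \<ge> 1" "t = mu_rad R n" by auto
  have "is_nth_pos_zero (J_boundary R) n t"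
    unfolding n(2) mu_rad_def by (rule theI'[OF J_boundary_nth_zero[OF n(1)]])
  then show "t \<in> {t. 0 < t \<and> J_boundary R t = 0}" by (simp add: is_nth_pos_zero_def)
next
  fix t assume "t \<in> {t. 0 < t \<and> J_boundary R t = 0}"
  then obtain n where n: "n \<ge> 1" "is_nth_pos_zero (J_boundary R) n t"
    using is_nth_pos_zero_card[OF J_boundary_finite_zeros] by blast
  have "mu_rad R n = t"
    unfolding mu_rad_def using the1_equality[OF J_boundary_nth_zero[OF n(1)] n(2)] .
  then show "t \<in> mu_rad R ` {1..}" using n(1) by force
qed

section \<open>Integration over a disc by the radius\<close>

lemma measurable_lebesgue_on_borel:
  "f \<in> borel \<rightarrow>\<^sub>M N \<Longrightarrow> f \<in> lebesgue_on S \<rightarrow>\<^sub>M N"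
  by (simp add: measurable_restrict_space1 measurable_completion)

lemma finite_measure_disc: "finite_measure (lebesgue_on (ball (c::real^2) R))"
  by (intro finite_measure_lebesgue_on lmeasurable_ball)

lemma unit_ball_vol_dim2: "unit_ball_vol 2 = pi"
  using unit_ball_vol_even[of 1] by simp

lemma emeasure_disc: "r \<ge> 0 \<Longrightarrow> emeasure lborel (ball (0::real^2) r) = ennreal (pi * r\<^sup>2)"
  "r \<ge> 0 \<Longrightarrow> emeasure lborel (cball (0::real^2) r) = ennreal (pi * r\<^sup>2)"
  using emeasure_ball[of r "0::real^2"] emeasure_cball[of r "0::real^2"] by (simp_all add: unit_ball_vol_dim2)

definition radius_density :: "real \<Rightarrow> real \<Rightarrow> real" where
  "radius_density R s = 2 * pi * s * indicator {0<..<R} s"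

lemma radius_density_measurable [measurable]: "radius_density R \<in> borel_measurable borel"
  unfolding radius_density_def[abs_def] by measurable

lemma radius_density_nonneg: "radius_density R s \<ge> 0"
  by (simp add: radius_density_def indicator_def)

text \<open>
  The area element \<open>2 \<pi> s ds\<close> of radial integrands. Half-lines generate the Borel sets of the real
  line, so it suffices to compare the areas of concentric annuli.
\<close>

lemma distr_norm_disc:
  assumes "R > 0"
  shows "distr (lebesgue_on (ball (0::real^2) R)) borel norm = density lborel (\<lambda>s. ennreal (radius_density R s))"
    (is "?M = ?N")
proof (rule measure_eqI_lessThan)
  interpret finite_measure "lebesgue_on (ball (0::real^2) R)" by (rule finite_measure_disc)
  show "sets ?M = sets borel" "sets ?N = sets borel" by auto
  fix x :: real
  define a where "a = min (max x 0) R"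
  have a: "0 \<le> a" "a \<le> R" using assms by (auto simp: a_def)
  have "emeasure ?M {x<..} = emeasure (lebesgue_on (ball (0::real^2) R)) (norm -` {x<..} \<inter> ball 0 R)"
    by (subst emeasure_distr) (auto intro: measurable_lebesgue_on_borel)
  also have "\<dots> = emeasure lebesgue (norm -` {x<..} \<inter> ball (0::real^2) R)"
    by (rule emeasure_restrict_space) auto
  also have "\<dots> = ennreal (pi * R\<^sup>2 - pi * a\<^sup>2)"
  proof (cases "x < 0")
    case True
    then have "norm -` {x<..} \<inter> ball (0::real^2) R = ball 0 R" by (auto intro: less_le_trans[OF _ norm_ge_zero])
    then show ?thesis using True assms by (simp add: a_def emeasure_disc)
  next
    case False
    show ?thesis
    proof (cases "x < R")
      case True
      then have "norm -` {x<..} \<inter> ball (0::real^2) R = ball 0 R - cball 0 a" using False by (auto simp: a_def)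
      moreover have "emeasure lebesgue (ball (0::real^2) R - cball 0 a) = ennreal (pi * R\<^sup>2) - ennreal (pi * a\<^sup>2)"
        using True False a by (subst emeasure_Diff) (auto simp: emeasure_disc a_def)
      ultimately show ?thesis using a by (simp add: ennreal_minus)
    next
      case False
      then have "norm -` {x<..} \<inter> ball (0::real^2) R = {}" by auto
      moreover have "a = R" using False assms by (simp add: a_def)
      ultimately show ?thesis by simp
    qed
  qed
  finally have M: "emeasure ?M {x<..} = ennreal (pi * R\<^sup>2 - pi * a\<^sup>2)" .
  then show "emeasure ?M {x<..} < \<infinity>" by simp
  have "emeasure ?N {x<..} = (\<integral>\<^sup>+s. ennreal (radius_density R s) * indicator {x<..} s \<partial>lborel)"
    by (subst emeasure_density) auto
  also have "\<dots> = (\<integral>\<^sup>+s. ennreal (2 * pi * s) * indicator {a..R} s \<partial>lborel)"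
  proof (rule nn_integral_cong_AE)
    have "AE s in lborel. s \<noteq> a \<and> s \<noteq> R" by (simp add: AE_lborel_singleton)
    then show "AE s in lborel. ennreal (radius_density R s) * indicator {x<..} s = ennreal (2 * pi * s) * indicator {a..R} s"
      by eventually_elim (use assms in \<open>auto simp: radius_density_def a_def indicator_def\<close>)
  qed
  also have "\<dots> = ennreal (pi * R\<^sup>2 - pi * a\<^sup>2)"
    using a by (intro nn_integral_FTC_Icc) (auto intro!: derivative_eq_intros simp: field_simps)
  finally show "emeasure ?M {x<..} = emeasure ?N {x<..}" using M by simp
qed

lemma nn_integral_disc_norm:
  assumes "R > 0" and [measurable]: "k \<in> borel_measurable borel"
  shows "(\<integral>\<^sup>+y. k (norm y) \<partial>lebesgue_on (ball (0::real^2) R)) = (\<integral>\<^sup>+s. ennreal (radius_density R s) * k s \<partial>lborel)"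
proof -
  have "(\<integral>\<^sup>+y. k (norm y) \<partial>lebesgue_on (ball (0::real^2) R)) = (\<integral>\<^sup>+s. k s \<partial>distr (lebesgue_on (ball (0::real^2) R)) borel norm)"
    by (subst nn_integral_distr) (auto intro: measurable_lebesgue_on_borel)
  then show ?thesis unfolding distr_norm_disc[OF assms(1)] by (subst (asm) nn_integral_density) auto
qed

lemma integral_disc_norm:
  fixes k :: "real \<Rightarrow> real"
  assumes "R > 0" and [measurable]: "k \<in> borel_measurable borel"
  shows "(\<integral>y. k (norm y) \<partial>lebesgue_on (ball (0::real^2) R)) = (\<integral>s. radius_density R s * k s \<partial>lborel)"
proof -
  have "(\<integral>y. k (norm y) \<partial>lebesgue_on (ball (0::real^2) R)) = (\<integral>s. k s \<partial>distr (lebesgue_on (ball (0::real^2) R)) borel norm)"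
    by (subst integral_distr) (auto intro: measurable_lebesgue_on_borel)
  then show ?thesis unfolding distr_norm_disc[OF assms(1)]
    by (subst (asm) integral_density) (auto simp: radius_density_nonneg)
qed

lemma ln_sq_bound:
  assumes "s > (0::real)"
  shows "(ln s)\<^sup>2 \<le> 4 / s + (s::real)\<^sup>2"
proof (cases "s \<ge> 1")
  case True
  then have "(ln s)\<^sup>2 \<le> s\<^sup>2" using ln_bound[of s] by (intro power_mono) auto
  then show ?thesis using assms divide_pos_pos[of 4 s] by linarith
next
  case False
  have "ln (1 / sqrt s) \<le> 1 / sqrt s" using assms by (intro ln_bound) auto
  moreover have "ln (1 / sqrt s) = - ln s / 2" using assms by (simp add: ln_div ln_sqrt)
  ultimately have "- ln s \<le> 2 / sqrt s" by simp
  then have "(- ln s)\<^sup>2 \<le> (2 / sqrt s)\<^sup>2" using False assms by (intro power_mono) auto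
  also have "\<dots> = 4 / s" using assms by (simp add: power_divide)
  also have "\<dots> \<le> 4 / s + s\<^sup>2" by simp
  finally show ?thesis by simp
qed

lemma nn_integral_ln_norm_sq_finite:
  assumes "r > 0"
  shows "(\<integral>\<^sup>+y. ennreal ((ln (norm y))\<^sup>2) \<partial>lebesgue_on (ball (0::real^2) r)) < \<infinity>"
proof -
  have "(\<integral>\<^sup>+y. ennreal ((ln (norm y))\<^sup>2) \<partial>lebesgue_on (ball (0::real^2) r))
      = (\<integral>\<^sup>+s. ennreal (radius_density r s) * ennreal ((ln s)\<^sup>2) \<partial>lborel)"
    using assms by (rule nn_integral_disc_norm) auto
  also have "\<dots> \<le> (\<integral>\<^sup>+s. ennreal (2 * pi * (4 + r ^ 3)) * indicator {0<..<r} s \<partial>lborel)"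
  proof (intro nn_integral_mono)
    fix s :: real
    have "radius_density r s * (ln s)\<^sup>2 \<le> 2 * pi * (4 + r ^ 3) * indicator {0<..<r} s"
    proof (cases "0 < s \<and> s < r")
      case True
      then have "s * (ln s)\<^sup>2 \<le> s * (4 / s + s\<^sup>2)" using ln_sq_bound[of s] by (intro mult_left_mono) auto
      also have "\<dots> = 4 + s ^ 3" using True by (simp add: field_simps power2_eq_square power3_eq_cube)
      also have "\<dots> \<le> 4 + r ^ 3" using True by (simp add: power_mono)
      finally have "2 * pi * (s * (ln s)\<^sup>2) \<le> 2 * pi * (4 + r ^ 3)" by (intro mult_left_mono) auto
      then show ?thesis using True by (simp add: radius_density_def mult.assoc)
    qed (auto simp: radius_density_def)
    then show "ennreal (radius_density r s) * ennreal ((ln s)\<^sup>2) \<le> ennreal (2 * pi * (4 + r ^ 3)) * indicator {0<..<r} s"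
      using assms by (simp add: radius_density_nonneg flip: ennreal_mult ennreal_indicator)
  qed
  also have "\<dots> = ennreal (2 * pi * (4 + r ^ 3)) * ennreal r"
    using assms by (simp add: nn_integral_cmult_indicator)
  also have "\<dots> < \<infinity>" by (simp add: ennreal_mult_less_top)
  finally show ?thesis .
qed

lemma nn_integral_lebesgue_on_borel:
  assumes [measurable]: "f \<in> borel_measurable borel" and [measurable]: "S \<in> sets borel"
  shows "(\<integral>\<^sup>+y. f y \<partial>lebesgue_on S) = (\<integral>\<^sup>+y. f y * indicator S y \<partial>lborel)"
  by (simp add: nn_integral_restrict_space nn_integral_completion)

text \<open>
  Uniform local square integrability of the logarithm: for \<open>x\<close> in the disc, the disc lies in the disc of
  twice the radius about \<open>x\<close>.
\<close>

lemma nn_integral_ln_kernel_bound: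
  assumes "R > 0"
  shows "\<exists>C. \<forall>x\<in>ball (0::real^2) R. (\<integral>\<^sup>+y. ennreal ((ln (norm (x - y)))\<^sup>2) \<partial>lebesgue_on (ball 0 R)) \<le> ennreal C"
proof -
  have [measurable]: "ball (0::real^2) r \<in> sets borel" for r by simp
  let ?I = "\<integral>\<^sup>+y. ennreal ((ln (norm y))\<^sup>2) \<partial>lebesgue_on (ball (0::real^2) (2 * R))"
  have "?I < \<infinity>" using assms by (intro nn_integral_ln_norm_sq_finite) auto
  then obtain C where C: "?I = ennreal C" by (cases ?I) auto
  have "(\<integral>\<^sup>+y. ennreal ((ln (norm (x - y)))\<^sup>2) \<partial>lebesgue_on (ball 0 R)) \<le> ennreal C"
    if x: "x \<in> ball 0 R" for x :: "real^2"
  proof -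
    have "(\<integral>\<^sup>+y. ennreal ((ln (norm (x - y)))\<^sup>2) \<partial>lebesgue_on (ball 0 R))
      = (\<integral>\<^sup>+y. ennreal ((ln (norm (x - y)))\<^sup>2) * indicator (ball 0 R) y \<partial>lborel)"
      by (rule nn_integral_lebesgue_on_borel) auto
    also have "\<dots> \<le> (\<integral>\<^sup>+y. ennreal ((ln (norm (x - y)))\<^sup>2) * indicator (ball 0 (2 * R)) (- x + y) \<partial>lborel)"
    proof (intro nn_integral_mono mult_left_mono)
      fix y show "(indicator (ball 0 R) y :: ennreal) \<le> indicator (ball 0 (2 * R)) (- x + y)"
        using x norm_triangle_ineq4[of y x] by (auto simp: indicator_def)
    qed auto
    also have "\<dots> = (\<integral>\<^sup>+y. ennreal ((ln (norm y))\<^sup>2) * indicator (ball 0 (2 * R)) y \<partial>distr lborel borel ((+) (- x)))"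
      by (subst nn_integral_distr) (measurable, auto simp: norm_minus_commute)
    also have "\<dots> = ?I"
      unfolding lborel_distr_plus by (rule nn_integral_lebesgue_on_borel[symmetric]) auto
    finally show ?thesis unfolding C .
  qed
  then show ?thesis by blast
qed

section \<open>Square-integrable functions and integral kernels\<close>

definition square_integrable :: "'a measure \<Rightarrow> ('a \<Rightarrow> real) \<Rightarrow> bool" where
  "square_integrable M u \<longleftrightarrow> u \<in> borel_measurable M \<and> integrable M (\<lambda>x. (u x)\<^sup>2)"

lemma square_integrable_iff_nn:
  "square_integrable M u \<longleftrightarrow> u \<in> borel_measurable M \<and> (\<integral>\<^sup>+x. ennreal ((u x)\<^sup>2) \<partial>M) < \<infinity>"
  unfolding square_integrable_def by (auto simp: integrable_iff_bounded)

lemma square_integrable_mult: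
  assumes "square_integrable M u" "square_integrable M v"
  shows "integrable M (\<lambda>x. u x * v x)"
proof (rule Bochner_Integration.integrable_bound)
  show "integrable M (\<lambda>x. (u x)\<^sup>2 + (v x)\<^sup>2)" using assms by (auto simp: square_integrable_def)
  show "(\<lambda>x. u x * v x) \<in> borel_measurable M" using assms by (auto simp: square_integrable_def)
  have "\<bar>a * b\<bar> \<le> a\<^sup>2 + b\<^sup>2" for a b :: real
    using sum_squares_bound[of "\<bar>a\<bar>" "\<bar>b\<bar>"] mult_nonneg_nonneg[of "\<bar>a\<bar>" "\<bar>b\<bar>"]
    unfolding abs_mult power2_abs by linarith
  then show "AE x in M. norm (u x * v x) \<le> norm ((u x)\<^sup>2 + (v x)\<^sup>2)" by (auto simp: abs_mult)
qed

lemma square_integrable_bounded_mult: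
  assumes "square_integrable M u" "f \<in> borel_measurable M" "AE x in M. \<bar>f x\<bar> \<le> B"
  shows "square_integrable M (\<lambda>x. f x * u x)"
proof -
  have "integrable M (\<lambda>x. (f x * u x)\<^sup>2)"
  proof (rule Bochner_Integration.integrable_bound)
    show "integrable M (\<lambda>x. B\<^sup>2 * (u x)\<^sup>2)" using assms by (auto simp: square_integrable_def)
    show "(\<lambda>x. (f x * u x)\<^sup>2) \<in> borel_measurable M" using assms by (auto simp: square_integrable_def)
    show "AE x in M. norm ((f x * u x)\<^sup>2) \<le> norm (B\<^sup>2 * (u x)\<^sup>2)"
      using assms(3) by eventually_elim
        (auto simp: power_mult_distrib abs_le_square_iff[symmetric] intro!: mult_right_mono)
  qed
  then show ?thesis using assms by (auto simp: square_integrable_def)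
qed

lemma square_integrable_bounded:
  assumes "finite_measure M" "f \<in> borel_measurable M" "AE x in M. \<bar>f x\<bar> \<le> B"
  shows "square_integrable M f"
proof -
  interpret finite_measure M by fact
  have "square_integrable M (\<lambda>_. 1)" by (simp add: square_integrable_def)
  from square_integrable_bounded_mult[OF this assms(2,3)] show ?thesis by simp
qed

lemma square_integrable_lincomb:
  assumes "square_integrable M u" "square_integrable M v"
  shows "square_integrable M (\<lambda>x. a * u x + b * v x)"
proof -
  have "integrable M (\<lambda>x. a\<^sup>2 * (u x)\<^sup>2 + 2 * a * b * (u x * v x) + b\<^sup>2 * (v x)\<^sup>2)"
    using assms square_integrable_mult[OF assms] by (auto simp: square_integrable_def)
  moreover have "(\<lambda>x. (a * u x + b * v x)\<^sup>2) = (\<lambda>x. a\<^sup>2 * (u x)\<^sup>2 + 2 * a * b * (u x * v x) + b\<^sup>2 * (v x)\<^sup>2)"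
    by (auto simp: power2_eq_square algebra_simps)
  ultimately show ?thesis using assms by (auto simp: square_integrable_def)
qed

lemma square_integrable_integrable:
  assumes "finite_measure M" "square_integrable M u"
  shows "integrable M u"
proof -
  interpret finite_measure M by fact
  have "square_integrable M (\<lambda>_. 1)" by (simp add: square_integrable_def)
  from square_integrable_mult[OF this assms(2)] show ?thesis by simp
qed

text \<open>
  From \<open>|k u v| \<le> k\<^sup>2 u\<^sup>2 + v\<^sup>2\<close> and Tonelli's theorem. This justifies each exchange of integrals below.
\<close>

lemma kernel_integrable:
  fixes k :: "'a \<Rightarrow> 'b \<Rightarrow> real"
  assumes "finite_measure M" "finite_measure N"
    and k [measurable]: "case_prod k \<in> borel_measurable (M \<Otimes>\<^sub>M N)"
    and bound: "\<And>x. x \<in> space M \<Longrightarrow> (\<integral>\<^sup>+y. ennreal ((k x y)\<^sup>2) \<partial>N) \<le> ennreal C"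
    and u: "square_integrable M u" and v: "square_integrable N v"
  shows "integrable (M \<Otimes>\<^sub>M N) (\<lambda>(x, y). k x y * u x * v y)"
proof -
  interpret M: finite_measure M by fact
  interpret N: finite_measure N by fact
  interpret pair_sigma_finite M N ..
  have um [measurable]: "u \<in> borel_measurable M" and vm [measurable]: "v \<in> borel_measurable N"
    using u v by (auto simp: square_integrable_def)
  have le: "ennreal \<bar>a * b * c\<bar> \<le> ennreal (a\<^sup>2) * ennreal (b\<^sup>2) + ennreal (c\<^sup>2)" for a b c :: real
  proof -
    have "\<bar>a * b\<bar> * \<bar>c\<bar> \<le> \<bar>a * b\<bar>\<^sup>2 + \<bar>c\<bar>\<^sup>2"
      using sum_squares_bound[of "\<bar>a * b\<bar>" "\<bar>c\<bar>"] mult_nonneg_nonneg[of "\<bar>a * b\<bar>" "\<bar>c\<bar>"]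
      by linarith
    then show ?thesis
      by (simp add: power_mult_distrib abs_mult flip: ennreal_mult ennreal_plus)
  qed
  have "(\<integral>\<^sup>+z. ennreal (norm (case z of (x, y) \<Rightarrow> k x y * u x * v y)) \<partial>(M \<Otimes>\<^sub>M N))
      = (\<integral>\<^sup>+x. \<integral>\<^sup>+y. ennreal \<bar>k x y * u x * v y\<bar> \<partial>N \<partial>M)"
    by (subst N.nn_integral_fst[symmetric]) (auto simp: split_beta')
  also have "\<dots> \<le> (\<integral>\<^sup>+x. ennreal C * ennreal ((u x)\<^sup>2) + (\<integral>\<^sup>+y. ennreal ((v y)\<^sup>2) \<partial>N) \<partial>M)"
  proof (intro nn_integral_mono)
    fix x assume x: "x \<in> space M"
    have [measurable]: "k x \<in> borel_measurable N" using measurable_Pair2[OF k x] by simp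
    have "(\<integral>\<^sup>+y. ennreal \<bar>k x y * u x * v y\<bar> \<partial>N) \<le> (\<integral>\<^sup>+y. ennreal ((k x y)\<^sup>2) * ennreal ((u x)\<^sup>2) + ennreal ((v y)\<^sup>2) \<partial>N)"
      by (intro nn_integral_mono le)
    also have "\<dots> = (\<integral>\<^sup>+y. ennreal ((k x y)\<^sup>2) \<partial>N) * ennreal ((u x)\<^sup>2) + (\<integral>\<^sup>+y. ennreal ((v y)\<^sup>2) \<partial>N)"
      by (subst nn_integral_add) (auto simp: nn_integral_multc)
    also have "\<dots> \<le> ennreal C * ennreal ((u x)\<^sup>2) + (\<integral>\<^sup>+y. ennreal ((v y)\<^sup>2) \<partial>N)"
      by (intro add_mono mult_right_mono bound x) auto
    finally show "(\<integral>\<^sup>+y. ennreal \<bar>k x y * u x * v y\<bar> \<partial>N) \<le> \<dots>" .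
  qed
  also have "\<dots> = ennreal C * (\<integral>\<^sup>+x. ennreal ((u x)\<^sup>2) \<partial>M) + (\<integral>\<^sup>+y. ennreal ((v y)\<^sup>2) \<partial>N) * emeasure M (space M)"
    by (subst nn_integral_add) (auto simp: nn_integral_cmult)
  also have "\<dots> < \<infinity>"
    using u v M.emeasure_finite[of "space M"]
    by (auto simp: square_integrable_iff_nn ennreal_mult_eq_top_iff less_top[symmetric])
  finally show ?thesis by (intro integrableI_bounded) auto
qed

lemma kernel_integrable_section:
  fixes k :: "'b \<Rightarrow> real"
  assumes k: "k \<in> borel_measurable N" "(\<integral>\<^sup>+y. ennreal ((k y)\<^sup>2) \<partial>N) \<le> ennreal C"
    and v: "square_integrable N v"
  shows "integrable N (\<lambda>y. k y * v y)"
proof -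
  have "square_integrable N k" using k by (auto simp: square_integrable_iff_nn intro: le_less_trans)
  then show ?thesis by (rule square_integrable_mult[OF _ v])
qed

section \<open>Averaging the logarithm over rotations\<close>

text \<open>
  Cauchy's integral formula at the centre of the unit circle for the holomorphic function
  \<open>Ln (1 - z \<zeta>)\<close>, which vanishes there.
\<close>

lemma ln_mean_unit_circle:
  fixes \<zeta> :: complex
  assumes "norm \<zeta> < 1"
  shows "((\<lambda>t. ln (norm (1 - cis (2 * pi * t) * \<zeta>))) has_integral 0) {0..1}"
proof -
  have re: "Re (1 - z * \<zeta>) > 0" if "norm z \<le> 1" for z
  proof -
    have "norm (z * \<zeta>) \<le> 1 * norm \<zeta>" unfolding norm_mult using that by (intro mult_right_mono) auto
    then show ?thesis using complex_Re_le_cmod[of "z * \<zeta>"] assms by simp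
  qed
  have hol: "(\<lambda>z. Ln (1 - z * \<zeta>)) holomorphic_on cball 0 1"
    using re by (intro holomorphic_intros) (force simp: complex_nonpos_Reals_iff)
  have "((\<lambda>z. Ln (1 - z * \<zeta>) / (z - 0)) has_contour_integral (2 * of_real pi * \<i> * Ln (1 - 0 * \<zeta>))) (circlepath 0 1)"
    by (rule Cauchy_integral_circlepath_simple[OF hol]) auto
  then have "((\<lambda>t. Ln (1 - circlepath 0 1 t * \<zeta>) / (circlepath 0 1 t - 0)
      * vector_derivative (circlepath 0 1) (at t within {0..1})) has_integral 0) {0..1}"
    by (simp add: has_contour_integral_def)
  then have "((\<lambda>t. 2 * pi * \<i> * Ln (1 - cis (2 * pi * t) * \<zeta>)) has_integral 0) {0..1}"
  proof (rule has_integral_eq[rotated])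
    fix t :: real assume t: "t \<in> {0..1}"
    have "circlepath 0 1 t = cis (2 * pi * t)" by (simp add: circlepath cis_conv_exp mult_ac)
    moreover have "vector_derivative (circlepath 0 1) (at t within {0..1}) = 2 * pi * \<i> * cis (2 * pi * t)"
      using t by (subst vector_derivative_circlepath01) (auto simp: cis_conv_exp mult_ac)
    ultimately show "Ln (1 - circlepath 0 1 t * \<zeta>) / (circlepath 0 1 t - 0)
      * vector_derivative (circlepath 0 1) (at t within {0..1}) = 2 * pi * \<i> * Ln (1 - cis (2 * pi * t) * \<zeta>)"
      by simp
  qed
  from has_integral_mult_right[OF this, of "1 / (2 * pi * \<i>)"]
  have "((\<lambda>t. Ln (1 - cis (2 * pi * t) * \<zeta>)) has_integral 0) {0..1}" by simp
  from has_integral_Re[OF this]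
  have "((\<lambda>t. Re (Ln (1 - cis (2 * pi * t) * \<zeta>))) has_integral 0) {0..1}" by simp
  moreover have "1 - cis s * \<zeta> \<noteq> 0" for s using re[of "cis s"] by force
  ultimately show ?thesis by simp
qed

text \<open>
  Factoring out the number of larger modulus reduces both cases to the previous lemma; when \<open>\<eta>\<close> is the
  larger one, conjugation turns the inverse rotation into the given one.
\<close>

lemma ln_mean_circle:
  fixes \<xi> \<eta> :: complex
  assumes "norm \<xi> \<noteq> norm \<eta>"
  shows "((\<lambda>t. ln (norm (\<xi> - cis (2 * pi * t) * \<eta>))) has_integral ln (max (norm \<xi>) (norm \<eta>))) {0..1}"
proof -
  have main: "((\<lambda>t. ln r + ln (norm (1 - cis (2 * pi * t) * \<zeta>))) has_integral ln r) {0..1}"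
    if "norm \<zeta> < 1" for r :: real and \<zeta>
    using has_integral_add[OF has_integral_const_real[of "ln r" 0 1] ln_mean_unit_circle[OF that]] by simp
  have nz: "norm (1 - cis s * \<zeta>) > 0" if "norm \<zeta> < 1" for s \<zeta>
  proof -
    have "norm (cis s * \<zeta>) < 1" using that by (simp add: norm_mult)
    then show ?thesis by (metis norm_one less_irrefl eq_iff_diff_eq_0 zero_less_norm_iff)
  qed
  show ?thesis
  proof (cases "norm \<eta> < norm \<xi>")
    case True
    then have \<xi>: "\<xi> \<noteq> 0" by auto
    with True have n: "norm (\<eta> / \<xi>) < 1" by (simp add: norm_divide)
    have "ln (norm \<xi>) + ln (norm (1 - cis s * (\<eta> / \<xi>))) = ln (norm (\<xi> - cis s * \<eta>))" for s
    proof -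
      have "\<xi> - cis s * \<eta> = \<xi> * (1 - cis s * (\<eta> / \<xi>))" using \<xi> by (simp add: field_simps)
      then show ?thesis using \<xi> nz[OF n, of s] by (simp add: norm_mult ln_mult)
    qed
    then show ?thesis using main[OF n, of "norm \<xi>"] True by simp
  next
    case False
    then have \<eta>: "\<eta> \<noteq> 0" using assms by auto
    with False have n: "norm (cnj (\<xi> / \<eta>)) < 1" using assms by (simp add: norm_divide)
    have "ln (norm \<eta>) + ln (norm (1 - cis s * cnj (\<xi> / \<eta>))) = ln (norm (\<xi> - cis s * \<eta>))" for s
    proof -
      have "\<xi> - cis s * \<eta> = - (cis s * \<eta>) * cnj (1 - cis s * cnj (\<xi> / \<eta>))"
        using \<eta> by (simp add: algebra_simps cis_cnj cis_mult)
      then have "norm (\<xi> - cis s * \<eta>) = norm \<eta> * norm (1 - cis s * cnj (\<xi> / \<eta>))"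
        by (simp only: norm_mult norm_minus_cancel complex_mod_cnj norm_cis mult_1)
      then show ?thesis using \<eta> nz[OF n, of s] by (simp add: ln_mult)
    qed
    then show ?thesis using main[OF n, of "norm \<eta>"] False by simp
  qed
qed

definition rot :: "real \<Rightarrow> real ^ 2 \<Rightarrow> real ^ 2" where
  "rot t x = (cos t * x $ 1 - sin t * x $ 2) *\<^sub>R axis 1 1 + (sin t * x $ 1 + cos t * x $ 2) *\<^sub>R axis 2 1"

lemma rot_nth [simp]: "rot t x $ 1 = cos t * x $ 1 - sin t * x $ 2"
  "rot t x $ 2 = sin t * x $ 1 + cos t * x $ 2"
  by (auto simp: rot_def axis_def)

text \<open>
  The isometry that turns a rotation of the plane into multiplication by a unit complex number.
\<close>

definition to_complex :: "real ^ 2 \<Rightarrow> complex" where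
  "to_complex x = Complex (x $ 1) (x $ 2)"

lemma norm_to_complex [simp]: "norm (to_complex x) = norm x"
  by (simp add: to_complex_def cmod_def norm_vec_def L2_set_def sum_2)

lemma to_complex_rot: "to_complex (rot t x) = cis t * to_complex x"
  by (simp add: to_complex_def complex_eq_iff algebra_simps)

lemma to_complex_diff: "to_complex (x - y) = to_complex x - to_complex y"
  by (simp add: to_complex_def complex_eq_iff)

lemma norm_rot [simp]: "norm (rot t x) = norm x"
  by (metis norm_to_complex to_complex_rot norm_mult norm_cis mult_1)

lemma rot_inverse [simp]: "rot (- t) (rot t x) = x" "rot t (rot (- t) x) = x"
proof -
  have inj: "to_complex a = to_complex b \<Longrightarrow> a = b" for a b
    by (simp add: to_complex_def vec_eq_iff forall_2)
  show "rot (- t) (rot t x) = x" "rot t (rot (- t) x) = x"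
    by (auto intro!: inj simp: to_complex_rot cis_mult simp flip: mult.assoc)
qed

lemma orthogonal_rot: "orthogonal_transformation (rot t)"
  unfolding orthogonal_transformation
proof
  show "linear (rot t)"
    by (intro linearI) (auto simp: vec_eq_iff forall_2 algebra_simps)
qed simp

lemma ln_mean_rot:
  assumes "norm x \<noteq> norm y"
  shows "((\<lambda>t. ln (norm (x - rot (2 * pi * t) y))) has_integral ln (max (norm x) (norm y))) {0..1}"
proof -
  have "norm (x - rot s y) = norm (to_complex x - cis s * to_complex y)" for s
    by (simp flip: to_complex_rot to_complex_diff)
  then show ?thesis using ln_mean_circle[of "to_complex x" "to_complex y"] assms by simp
qed

lemma sets_disc: "A \<in> sets (lebesgue_on (ball (0::real^2) R)) \<longleftrightarrow> A \<in> lmeasurable \<and> A \<subseteq> ball 0 R"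
proof
  assume "A \<in> sets (lebesgue_on (ball (0::real^2) R))"
  then have "A \<in> sets lebesgue" "A \<subseteq> ball 0 R" by (auto simp: sets_restrict_space)
  then show "A \<in> lmeasurable \<and> A \<subseteq> ball 0 R"
    using fmeasurableI2[OF lmeasurable_ball] by blast
qed (auto simp: sets_restrict_space intro!: image_eqI fmeasurableD)

lemma distr_rot: "rot t \<in> lebesgue_on (ball 0 R) \<rightarrow>\<^sub>M lebesgue_on (ball 0 R)"
  "distr (lebesgue_on (ball 0 R)) (lebesgue_on (ball 0 R)) (rot t) = lebesgue_on (ball 0 R)"
proof -
  have vim: "rot t -` A \<inter> ball 0 R = rot (- t) ` A" if "A \<subseteq> ball 0 R" for A
    using that by (auto intro!: image_eqI[of _ "rot (- t)" "rot t _"] simp: subset_iff)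
  have im: "rot (- t) ` A \<in> sets (lebesgue_on (ball 0 R))" if "A \<in> sets (lebesgue_on (ball 0 R))" for A
    using that measurable_orthogonal_image[OF orthogonal_rot] by (auto simp: sets_disc)
  show m: "rot t \<in> lebesgue_on (ball 0 R) \<rightarrow>\<^sub>M lebesgue_on (ball 0 R)"
    using im vim by (intro measurableI) (auto simp: sets_disc)
  show "distr (lebesgue_on (ball 0 R)) (lebesgue_on (ball 0 R)) (rot t) = lebesgue_on (ball 0 R)"
  proof (rule measure_eqI)
    fix A assume "A \<in> sets (distr (lebesgue_on (ball 0 R)) (lebesgue_on (ball 0 R)) (rot t))"
    then have A: "A \<in> sets (lebesgue_on (ball 0 R))" by simp
    have l: "A \<in> lmeasurable" "rot (- t) ` A \<in> lmeasurable" "A \<subseteq> ball 0 R"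
      using A im[OF A] by (auto simp: sets_disc)
    have "emeasure (lebesgue_on (ball 0 R)) (rot (- t) ` A) = emeasure (lebesgue_on (ball 0 R)) A"
      using l im[OF A] measure_orthogonal_image[OF orthogonal_rot l(1), of "- t"]
      by (subst (1 2) emeasure_restrict_space) (auto simp: emeasure_eq_measure2 sets_disc)
    then show "emeasure (distr (lebesgue_on (ball 0 R)) (lebesgue_on (ball 0 R)) (rot t)) A = emeasure (lebesgue_on (ball 0 R)) A"
      using A vim l m by (subst emeasure_distr) auto
  qed simp
qed

lemma measurable_pair_lebesgue_on:
  assumes "f \<in> borel_measurable (borel \<Otimes>\<^sub>M borel)"
  shows "f \<in> borel_measurable (lebesgue_on S \<Otimes>\<^sub>M lebesgue_on T)"
proof -
  have "(\<lambda>z. (fst z, snd z)) \<in> lebesgue_on S \<Otimes>\<^sub>M lebesgue_on T \<rightarrow>\<^sub>M borel \<Otimes>\<^sub>M borel"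
    by (intro measurable_Pair measurable_compose[OF measurable_fst] measurable_compose[OF measurable_snd]
        measurable_lebesgue_on_borel) auto
  from measurable_compose[OF this assms] show ?thesis by simp
qed

lemma AE_disc_norm_neq: "AE y in lebesgue_on (ball (0::real^2) R). norm y \<noteq> r"
proof -
  have "sphere (0::real^2) r \<in> null_sets lebesgue"
    using negligible_sphere negligible_iff_null_sets by blast
  then have "AE y in lebesgue. y \<notin> sphere (0::real^2) r" by (rule AE_not_in)
  then show ?thesis by (subst AE_restrict_space_iff) (auto elim: eventually_mono)
qed

text \<open>
  Since rotations preserve the measure and \<open>u\<close> is almost everywhere invariant under them, \<open>y\<close> may be
  replaced by its rotated copies in the kernel. Averaging over the rotations and exchanging the
  integrals leaves the mean of the kernel over circles.
\<close>

lemma radial_ln_potential: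
  assumes R: "R > 0" and u: "square_integrable (lebesgue_on (ball 0 R)) u"
    and rad: "AE x in lebesgue_on (ball 0 R). u x = g (norm x)" and x: "x \<in> ball (0::real^2) R"
  shows "(\<integral>y. ln (norm (x - y)) * u y \<partial>lebesgue_on (ball 0 R))
      = (\<integral>y. ln (max (norm x) (norm y)) * u y \<partial>lebesgue_on (ball 0 R))"
proof -
  let ?M = "lebesgue_on (ball (0::real^2) R)" and ?N = "lebesgue_on {0..1::real}"
  let ?k = "\<lambda>t y. ln (norm (x - rot (2 * pi * t) y))"
  let ?I = "\<integral>y. ln (norm (x - y)) * u y \<partial>?M"
  interpret M: finite_measure ?M by (rule finite_measure_disc)
  interpret N: finite_measure ?N by (rule finite_measure_lebesgue_on) auto
  interpret pair_sigma_finite ?N ?M ..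
  obtain C where C: "\<And>x. x \<in> ball (0::real^2) R \<Longrightarrow> (\<integral>\<^sup>+y. ennreal ((ln (norm (x - y)))\<^sup>2) \<partial>?M) \<le> ennreal C"
    using nn_integral_ln_kernel_bound[OF R] by blast
  have [measurable]: "u \<in> borel_measurable ?M" using u by (simp add: square_integrable_def)
  have lnm: "(\<lambda>y. ln (norm (x - y))) \<in> borel_measurable ?M"
    by (intro measurable_lebesgue_on_borel) measurable
  have rotm [measurable]: "rot s \<in> ?M \<rightarrow>\<^sub>M ?M" for s by (rule distr_rot)
  have rotI: "(\<integral>y. ?k t y * u y \<partial>?M) = ?I" for t
  proof -
    have "?I = (\<integral>y. ln (norm (x - y)) * u y \<partial>distr ?M ?M (rot (2 * pi * t)))" by (simp add: distr_rot)
    also have "\<dots> = (\<integral>y. ?k t y * u (rot (2 * pi * t) y) \<partial>?M)"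
      using lnm by (subst integral_distr) auto
    also have "\<dots> = (\<integral>y. ?k t y * u y \<partial>?M)"
    proof (rule integral_cong_AE)
      have "AE y in distr ?M ?M (rot (2 * pi * t)). u y = g (norm y)" by (simp only: distr_rot(2) rad)
      from AE_distrD[OF rotm this] rad
      show "AE y in ?M. ?k t y * u (rot (2 * pi * t) y) = ?k t y * u y" by eventually_elim simp
    qed (use lnm measurable_compose[OF rotm lnm] in measurable)
    finally show ?thesis ..
  qed
  have kb: "(\<integral>\<^sup>+y. ennreal ((?k t y)\<^sup>2) \<partial>?M) \<le> ennreal C" for t
  proof -
    have "(\<integral>\<^sup>+y. ennreal ((ln (norm (x - y)))\<^sup>2) \<partial>?M)
        = (\<integral>\<^sup>+y. ennreal ((ln (norm (x - y)))\<^sup>2) \<partial>distr ?M ?M (rot (2 * pi * t)))" by (simp add: distr_rot)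
    also have "\<dots> = (\<integral>\<^sup>+y. ennreal ((?k t y)\<^sup>2) \<partial>?M)"
      using lnm by (subst nn_integral_distr) auto
    finally show ?thesis using C[OF x] by simp
  qed
  have km: "case_prod ?k \<in> borel_measurable (?N \<Otimes>\<^sub>M ?M)"
  proof (rule measurable_pair_lebesgue_on)
    have "continuous_on UNIV (\<lambda>z :: real \<times> (real^2). norm (x - rot (2 * pi * fst z) (snd z)))"
      unfolding rot_def by (intro continuous_intros)
    then have [measurable]: "(\<lambda>z :: real \<times> (real^2). norm (x - rot (2 * pi * fst z) (snd z))) \<in> borel_measurable (borel \<Otimes>\<^sub>M borel)"
      by (simp add: borel_prod borel_measurable_continuous_onI)
    show "case_prod ?k \<in> borel_measurable (borel \<Otimes>\<^sub>M borel)"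
      unfolding split_beta' by measurable
  qed
  have int: "integrable (?N \<Otimes>\<^sub>M ?M) (\<lambda>(t, y). ?k t y * 1 * u y)"
    by (rule kernel_integrable[OF N.finite_measure_axioms M.finite_measure_axioms km kb _ u])
      (simp add: square_integrable_def)
  have "?I = (\<integral>t. ?I \<partial>?N)" by (simp add: measure_restrict_space)
  also have "\<dots> = (\<integral>t. \<integral>y. ?k t y * u y \<partial>?M \<partial>?N)" by (simp add: rotI)
  also have "\<dots> = (\<integral>y. \<integral>t. ?k t y * u y \<partial>?N \<partial>?M)"
    using Fubini_integral[of "\<lambda>t y. ?k t y * u y"] int by simp
  also have "\<dots> = (\<integral>y. ln (max (norm x) (norm y)) * u y \<partial>?M)"
  proof (rule integral_cong_AE)
    show "AE y in ?M. (\<integral>t. ?k t y * u y \<partial>?N) = ln (max (norm x) (norm y)) * u y"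
      using AE_disc_norm_neq[where R=R and r="norm x"]
    proof eventually_elim
      case (elim y)
      have nz: "x \<noteq> rot s y" for s using elim by auto
      have "continuous_on {0..1} (\<lambda>t. ?k t y)"
        using nz unfolding rot_def by (intro continuous_intros) (auto simp: rot_def[symmetric])
      then have "integrable ?N (\<lambda>t. ?k t y)" by (rule continuous_imp_integrable_real)
      then have "(\<integral>t. ?k t y \<partial>?N) = integral {0..1} (\<lambda>t. ?k t y)"
        by (rule lebesgue_integral_eq_integral) auto
      also have "\<dots> = ln (max (norm x) (norm y))"
        using ln_mean_rot[of x y] elim by (intro integral_unique) auto
      finally show ?case by simp
    qed
    show "(\<lambda>y. \<integral>t. ?k t y * u y \<partial>?N) \<in> borel_measurable ?M"
      using borel_measurable_integrable[OF integrable_snd[of "\<lambda>t y. ?k t y * u y"]] int by simp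
    show "(\<lambda>y. ln (max (norm x) (norm y)) * u y) \<in> borel_measurable ?M"
    proof -
      have [measurable]: "(\<lambda>y. ln (max (norm x) (norm y))) \<in> borel_measurable ?M"
        by (intro measurable_lebesgue_on_borel) measurable
      show ?thesis by measurable
    qed
  qed
  finally show ?thesis .
qed

section \<open>The radial integral equation\<close>

text \<open>
  The boundary expression \<open>j(R) - ln R \<cdot> R j'(R)\<close> of the profile \<open>j = bess \<kappa>\<close>. It vanishes when \<open>j\<close>
  continues outside the disc as a multiple of \<open>ln |x|\<close> with matching value and slope.
\<close>

definition robin :: "real \<Rightarrow> real \<Rightarrow> real" where
  "robin R \<kappa> = bess \<kappa> R - ln R * bess_flux \<kappa> R"

text \<open>
  The logarithmic potential of the radial function \<open>f(|x|)\<close> at radius \<open>r\<close>, with the opposite sign.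
\<close>

definition log_kernel_integral :: "real \<Rightarrow> (real \<Rightarrow> real) \<Rightarrow> real \<Rightarrow> real" where
  "log_kernel_integral R f r = (\<integral>s. indicator {0<..<R} s * (s * ln (max r s) * f s) \<partial>lborel)"

lemma integrable_indicator_bounded:
  fixes f :: "real \<Rightarrow> real"
  assumes [measurable]: "f \<in> borel_measurable borel" and "\<And>s. a < s \<Longrightarrow> s < b \<Longrightarrow> \<bar>f s\<bar> \<le> B"
  shows "integrable lborel (\<lambda>s. indicator {a<..<b} s * f s)"
proof (rule Bochner_Integration.integrable_bound)
  show "integrable lborel (\<lambda>s. B * indicator {a<..<b} s :: real)"
    by (cases "a \<le> b") (auto intro!: integrable_mult_right integrable_real_indicator)
  show "AE s in lborel. norm (indicator {a<..<b} s * f s) \<le> norm (B * indicator {a<..<b} s :: real)"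
    using assms(2) by (auto simp: indicator_def intro!: AE_I2 order_trans[OF _ abs_ge_self])
qed auto

lemma mult_ln_quotient_bound:
  assumes "0 < s" "s \<le> (r::real)"
  shows "0 \<le> s * ln (r / s)" "s * ln (r / s) \<le> r"
proof -
  show "0 \<le> s * ln (r / s)" using assms by simp
  have "s * ln (r / s) \<le> s * (r / s)" using assms ln_bound[of "r / s"] by (intro mult_left_mono) auto
  then show "s * ln (r / s) \<le> r" using assms by simp
qed

text \<open>
  Integration by parts with \<open>(s j')' = \<kappa> s j\<close>, separately on both sides of the kink at \<open>r\<close>. The
  constant that remains is the boundary expression.
\<close>

lemma log_kernel_integral_bess:
  assumes r: "0 < r" "r < R" and \<kappa>: "\<kappa> \<noteq> 0"
  shows "log_kernel_integral R (bess \<kappa>) r = (bess \<kappa> r - robin R \<kappa>) / \<kappa>"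
proof -
  have cj: "isCont (bess \<kappa>) s" for s
    using continuous_bess[of UNIV \<kappa>] by (simp add: continuous_on_eq_continuous_at)
  let ?f1 = "\<lambda>s. ln r * (s * bess \<kappa> s)" and ?f2 = "\<lambda>s. ln s * (s * bess \<kappa> s)"
  have i1: "integrable lborel (\<lambda>s. ?f1 s * indicator {0..r} s)"
    by (intro borel_integrable_atLeastAtMost continuous_intros cj)
  have i2: "integrable lborel (\<lambda>s. ?f2 s * indicator {r..R} s)"
    using r by (intro borel_integrable_atLeastAtMost continuous_intros cj) auto
  have v1: "(\<integral>s. ?f1 s * indicator {0..r} s \<partial>lborel) = ln r * bess_flux \<kappa> r / \<kappa> - ln r * bess_flux \<kappa> 0 / \<kappa>"
  proof (rule integral_FTC_Icc_real)
    fix s show "((\<lambda>s. ln r * bess_flux \<kappa> s / \<kappa>) has_real_derivative ?f1 s) (at s)"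
      using \<kappa> by (auto intro!: derivative_eq_intros bess_flux_deriv)
  qed (use r in \<open>auto intro!: continuous_intros cj\<close>)
  have v2: "(\<integral>s. ?f2 s * indicator {r..R} s \<partial>lborel)
      = (ln R * bess_flux \<kappa> R - bess \<kappa> R) / \<kappa> - (ln r * bess_flux \<kappa> r - bess \<kappa> r) / \<kappa>"
  proof (rule integral_FTC_Icc_real)
    fix s assume "r \<le> s" "s \<le> R"
    then show "((\<lambda>s. (ln s * bess_flux \<kappa> s - bess \<kappa> s) / \<kappa>) has_real_derivative ?f2 s) (at s)"
      using \<kappa> r by (auto intro!: derivative_eq_intros bess_flux_deriv bess_deriv simp: field_simps)
  qed (use r in \<open>auto intro!: continuous_intros cj\<close>)
  have "AE s in lborel. s \<noteq> 0 \<and> s \<noteq> r \<and> s \<noteq> R" by (simp add: AE_lborel_singleton)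
  then have "AE s in lborel. indicator {0<..<R} s * (s * ln (max r s) * bess \<kappa> s)
      = ?f1 s * indicator {0..r} s + ?f2 s * indicator {r..R} s"
    by eventually_elim (use r in \<open>auto simp: indicator_def max_def\<close>)
  moreover have "(\<lambda>s. indicator {0<..<R} s * (s * ln (max r s) * bess \<kappa> s)) \<in> borel_measurable lborel"
    by measurable
  ultimately have "log_kernel_integral R (bess \<kappa>) r
      = (\<integral>s. ?f1 s * indicator {0..r} s + ?f2 s * indicator {r..R} s \<partial>lborel)"
    unfolding log_kernel_integral_def using i1 i2 by (intro integral_cong_AE) auto
  also have "\<dots> = (bess \<kappa> r - robin R \<kappa>) / \<kappa>"
    using i1 i2 v1 v2 by (simp add: robin_def diff_divide_distrib add_divide_distrib)
  finally show ?thesis .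
qed

text \<open>
  Iterating the equation, with \<open>s ln (r / s) \<le> R\<close>, gives \<open>|D r| \<le> M (K r)\<^sup>n / n!\<close> for every \<open>n\<close>.
\<close>

lemma volterra_zero:
  fixes D :: "real \<Rightarrow> real"
  assumes [measurable]: "D \<in> borel_measurable borel"
    and bound: "\<And>r. 0 < r \<Longrightarrow> r < R \<Longrightarrow> \<bar>D r\<bar> \<le> M"
    and eq: "\<And>r. 0 < r \<Longrightarrow> r < R \<Longrightarrow> D r = a * (\<integral>s. indicator {0<..<r} s * (s * ln (r / s) * D s) \<partial>lborel)"
    and r: "0 < r" "r < R"
  shows "D r = 0"
proof -
  define K where "K = \<bar>a\<bar> * R"
  have M: "M \<ge> 0" using bound[OF r] by simp
  have K: "K \<ge> 0" using r by (simp add: K_def)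
  have iter: "\<bar>D r\<bar> \<le> M * (K * r) ^ n / fact n" if "0 < r" "r < R" for n r
    using that
  proof (induction n arbitrary: r)
    case 0 then show ?case using bound by simp
  next
    case (Suc n)
    let ?c = "M * K ^ n / fact n"
    have c: "?c \<ge> 0" using M K by simp
    have int: "integrable lborel (\<lambda>s. R * ?c * s ^ n * indicator {0..r} s)"
      by (intro borel_integrable_atLeastAtMost continuous_intros)
    have le: "\<bar>indicator {0<..<r} s * (s * ln (r / s) * D s)\<bar> \<le> R * ?c * s ^ n * indicator {0..r} s" for s
    proof (cases "0 < s \<and> s < r")
      case True
      have "\<bar>s * ln (r / s)\<bar> * \<bar>D s\<bar> \<le> R * (M * (K * s) ^ n / fact n)"
        using True Suc.prems mult_ln_quotient_bound[of s r] Suc.IH[of s] by (intro mult_mono) auto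
      then show ?thesis using True by (simp add: abs_mult power_mult_distrib mult_ac)
    next
      case False
      then have "indicator {0<..<r} s * (s * ln (r / s) * D s) = 0" by (auto simp: indicator_def)
      moreover have "0 \<le> R * ?c * s ^ n * indicator {0..r} s"
        using c Suc.prems by (cases "s \<in> {0..r}") (auto intro!: mult_nonneg_nonneg simp del: times_divide_eq_right)
      ultimately show ?thesis by (simp only: abs_zero)
    qed
    have "norm (\<integral>s. indicator {0<..<r} s * (s * ln (r / s) * D s) \<partial>lborel)
        \<le> (\<integral>s. R * ?c * s ^ n * indicator {0..r} s \<partial>lborel)"
    proof (rule Bochner_Integration.integral_norm_bound_integral[OF _ int])
      show "integrable lborel (\<lambda>s. indicator {0<..<r} s * (s * ln (r / s) * D s))"
      proof (rule Bochner_Integration.integrable_bound[OF int])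
        show "AE s in lborel. norm (indicator {0<..<r} s * (s * ln (r / s) * D s)) \<le> norm (R * ?c * s ^ n * indicator {0..r} s)"
          unfolding real_norm_def by (intro AE_I2 order_trans[OF le] abs_ge_self)
      qed measurable
    qed (use le in \<open>simp only: real_norm_def\<close>)
    also have "\<dots> = R * ?c * r ^ Suc n / Suc n - R * ?c * 0 ^ Suc n / Suc n"
    proof (rule integral_FTC_Icc_real)
      fix s :: real
      have "((\<lambda>s. (R * ?c / Suc n) * s ^ Suc n) has_real_derivative (R * ?c / Suc n) * (real (Suc n) * s ^ n)) (at s)"
        by (intro DERIV_cmult) (use DERIV_pow[of "Suc n" s UNIV] in simp)
      then show "((\<lambda>s. R * ?c * s ^ Suc n / Suc n) has_real_derivative R * ?c * s ^ n) (at s)"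
        by (simp del: of_nat_Suc add: mult.assoc)
    qed (use Suc.prems in \<open>auto intro!: continuous_intros\<close>)
    finally have "\<bar>D r\<bar> \<le> \<bar>a\<bar> * (R * ?c * r ^ Suc n / Suc n)"
      unfolding eq[OF Suc.prems] abs_mult[of a] real_norm_def by (intro mult_left_mono) auto
    also have "\<dots> = M * (K * r) ^ Suc n / fact (Suc n)"
      by (simp add: K_def power_mult_distrib field_simps)
    finally show ?case .
  qed
  have "(\<lambda>n. (K * r) ^ n / fact n) \<longlonglongrightarrow> 0"
    using summable_LIMSEQ_zero[OF summable_exp[of "K * r"]] by (simp add: field_simps)
  then have "(\<lambda>n. M * ((K * r) ^ n / fact n)) \<longlonglongrightarrow> M * 0" by (intro tendsto_intros)
  then have "\<bar>D r\<bar> \<le> 0"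
    using iter[OF r] by (intro LIMSEQ_le_const[of "\<lambda>n. M * ((K * r) ^ n / fact n)"]) auto
  then show ?thesis by simp
qed

lemma mult_ln_bounded:
  assumes "0 < s" "s < (R::real)"
  shows "\<bar>s * ln s\<bar> \<le> R + R * \<bar>ln R\<bar>"
proof -
  have "s * ln s = s * ln R - s * ln (R / s)" using assms by (simp add: ln_div algebra_simps)
  moreover have "\<bar>s * ln R\<bar> \<le> R * \<bar>ln R\<bar>" using assms by (auto simp: abs_mult intro!: mult_right_mono)
  ultimately show ?thesis using mult_ln_quotient_bound[of s R] assms by linarith
qed

text \<open>
  Writing \<open>ln (max r s)\<close> as \<open>ln s\<close> plus \<open>ln (r / s)\<close> on \<open>s < r\<close> exhibits the operator as a Volterra operator
  plus a constant.
\<close>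

lemma log_kernel_integral_split:
  assumes [measurable]: "f \<in> borel_measurable borel"
    and bound: "\<And>s. 0 < s \<Longrightarrow> s < R \<Longrightarrow> \<bar>f s\<bar> \<le> M" and r: "0 < r" "r < R"
  shows "log_kernel_integral R f r = (\<integral>s. indicator {0<..<R} s * (s * ln s * f s) \<partial>lborel)
    + (\<integral>s. indicator {0<..<r} s * (s * ln (r / s) * f s) \<partial>lborel)"
proof -
  have M: "M \<ge> 0" using bound[OF r] by simp
  have "integrable lborel (\<lambda>s. indicator {0<..<R} s * (s * ln s * f s))"
  proof (rule integrable_indicator_bounded)
    fix s assume "0 < s" "s < R"
    then show "\<bar>s * ln s * f s\<bar> \<le> (R + R * \<bar>ln R\<bar>) * M"
      unfolding abs_mult[of "s * ln s"] using mult_ln_bounded bound r by (intro mult_mono) auto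
  qed measurable
  moreover have "integrable lborel (\<lambda>s. indicator {0<..<r} s * (s * ln (r / s) * f s))"
  proof (rule integrable_indicator_bounded)
    fix s assume "0 < s" "s < r"
    then show "\<bar>s * ln (r / s) * f s\<bar> \<le> r * M"
      unfolding abs_mult[of "s * ln (r / s)"] using mult_ln_quotient_bound[of s r] bound r by (intro mult_mono) auto
  qed measurable
  ultimately have "(\<integral>s. indicator {0<..<R} s * (s * ln s * f s) \<partial>lborel)
    + (\<integral>s. indicator {0<..<r} s * (s * ln (r / s) * f s) \<partial>lborel)
    = (\<integral>s. indicator {0<..<R} s * (s * ln s * f s) + indicator {0<..<r} s * (s * ln (r / s) * f s) \<partial>lborel)"
    by simp
  also have "\<dots> = log_kernel_integral R f r"
    unfolding log_kernel_integral_def using r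
    by (intro Bochner_Integration.integral_cong) (auto simp: indicator_def max_def ln_div algebra_simps)
  finally show ?thesis ..
qed

lemma log_kernel_volterra_form:
  assumes [measurable]: "f \<in> borel_measurable borel"
    and bound: "\<And>s. 0 < s \<Longrightarrow> s < R \<Longrightarrow> \<bar>f s\<bar> \<le> M"
    and eq: "\<And>r. 0 < r \<Longrightarrow> r < R \<Longrightarrow> f r = b + \<kappa> * log_kernel_integral R f r"
  shows "\<exists>c. \<forall>r. 0 < r \<longrightarrow> r < R \<longrightarrow>
    f r = c + \<kappa> * (\<integral>s. indicator {0<..<r} s * (s * ln (r / s) * f s) \<partial>lborel)"
proof (intro exI allI impI)
  fix r assume r: "0 < r" "r < R"
  show "f r = (b + \<kappa> * (\<integral>s. indicator {0<..<R} s * (s * ln s * f s) \<partial>lborel))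
      + \<kappa> * (\<integral>s. indicator {0<..<r} s * (s * ln (r / s) * f s) \<partial>lborel)"
    using log_kernel_integral_split[OF assms(1,2) r] eq[OF r] by (simp only: distrib_left add.assoc)
qed

text \<open>
  Both \<open>f\<close> and \<open>bess \<kappa>\<close> satisfy a Volterra equation with the same kernel and some constant. The
  combination of the two in which the constants cancel is zero, and the constant of \<open>bess \<kappa>\<close> is nonzero,
  as otherwise \<open>bess \<kappa>\<close> itself would vanish.
\<close>

lemma log_kernel_solution_bess:
  assumes R: "R > 0" and \<kappa>: "\<kappa> \<noteq> 0" and fm [measurable]: "f \<in> borel_measurable borel"
    and bound: "\<And>s. 0 < s \<Longrightarrow> s < R \<Longrightarrow> \<bar>f s\<bar> \<le> M"
    and eq: "\<And>r. 0 < r \<Longrightarrow> r < R \<Longrightarrow> f r = \<kappa> * log_kernel_integral R f r"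
  shows "\<exists>c. (\<forall>r. 0 < r \<longrightarrow> r < R \<longrightarrow> f r = c * bess \<kappa> r) \<and> c * robin R \<kappa> = 0"
proof -
  let ?j = "bess \<kappa>"
  let ?V = "\<lambda>f r. \<integral>s. indicator {0<..<r} s * (s * ln (r / s) * f s) \<partial>lborel"
  note jm = bess_measurable[of \<kappa>]
  obtain N where N: "\<And>s. 0 < s \<Longrightarrow> s < R \<Longrightarrow> \<bar>?j s\<bar> \<le> N"
    using bess_bounded[of R \<kappa>] by (metis atLeastAtMost_iff less_imp_le)
  have jeq: "?j r = robin R \<kappa> + \<kappa> * log_kernel_integral R ?j r" if "0 < r" "r < R" for r
    using log_kernel_integral_bess[OF that \<kappa>] \<kappa> by simp
  obtain cf where cf: "\<And>r. 0 < r \<Longrightarrow> r < R \<Longrightarrow> f r = cf + \<kappa> * ?V f r"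
    using log_kernel_volterra_form[OF fm bound, of R 0 \<kappa>] eq unfolding add_0 by blast
  obtain cj where cj: "\<And>r. 0 < r \<Longrightarrow> r < R \<Longrightarrow> ?j r = cj + \<kappa> * ?V ?j r"
    using log_kernel_volterra_form[OF jm N jeq] by blast
  have Vint: "integrable lborel (\<lambda>s. indicator {0<..<r} s * (s * ln (r / s) * g s))"
    if "0 < r" "r < R" "g \<in> borel_measurable borel" "\<And>s. 0 < s \<Longrightarrow> s < R \<Longrightarrow> \<bar>g s\<bar> \<le> B" for g r B
  proof (rule integrable_indicator_bounded)
    fix s assume "0 < s" "s < r"
    then show "\<bar>s * ln (r / s) * g s\<bar> \<le> r * B"
      unfolding abs_mult[of "s * ln (r / s)"] using mult_ln_quotient_bound[of s r] that by (intro mult_mono) auto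
  qed (use that(3) in measurable)
  have cj0: "cj \<noteq> 0"
  proof
    assume "cj = 0"
    then have z: "?j r = 0" if "0 < r" "r < R" for r
      using volterra_zero[OF jm N, where a=\<kappa>] cj that by simp
    have "eventually (\<lambda>r. ?j r > 0) (at 0)"
      using continuous_bess[of UNIV \<kappa>] unfolding continuous_on_def
      by (intro order_tendstoD(1)[of _ 1]) (force dest!: spec[of _ 0])+
    then obtain d where d: "d > 0" "\<And>r. r \<noteq> 0 \<Longrightarrow> \<bar>r\<bar> < d \<Longrightarrow> ?j r > 0"
      by (auto simp: eventually_at dist_real_def)
    define r where "r = min d R / 2"
    have "0 < r" "r < d" "r < R" using d(1) R by (auto simp: r_def min_def)
    then show False using d(2)[of r] z[of r] by auto
  qed
  define D where "D = (\<lambda>r. cj * f r - cf * ?j r)"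
  have [measurable]: "D \<in> borel_measurable borel" unfolding D_def by measurable
  have "D r = 0" if r: "0 < r" "r < R" for r
  proof (rule volterra_zero[of D R "\<bar>cj\<bar> * M + \<bar>cf\<bar> * N" \<kappa>])
    fix r assume r: "0 < r" "r < R"
    have "\<bar>cj\<bar> * \<bar>f r\<bar> \<le> \<bar>cj\<bar> * M" "\<bar>cf\<bar> * \<bar>?j r\<bar> \<le> \<bar>cf\<bar> * N"
      using bound N r by (auto intro: mult_left_mono)
    then show "\<bar>D r\<bar> \<le> \<bar>cj\<bar> * M + \<bar>cf\<bar> * N"
      unfolding D_def abs_mult[symmetric] by linarith
    have VD: "?V D r = cj * ?V f r - cf * ?V ?j r"
    proof -
      have "?V D r = (\<integral>s. cj * (indicator {0<..<r} s * (s * ln (r / s) * f s)) - cf * (indicator {0<..<r} s * (s * ln (r / s) * ?j s)) \<partial>lborel)"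
        by (intro Bochner_Integration.integral_cong) (auto simp: D_def algebra_simps)
      then show ?thesis using Vint[OF r fm bound] Vint[OF r jm N] by simp
    qed
    have lin: "cj * p - cf * q = \<kappa> * (cj * X - cf * Y)" if "p = cf + \<kappa> * X" "q = cj + \<kappa> * Y" for p q X Y
      unfolding that by (simp add: algebra_simps)
    have "D r = cj * f r - cf * ?j r" by (simp add: D_def)
    also have "\<dots> = \<kappa> * (cj * ?V f r - cf * ?V ?j r)" by (rule lin[OF cf[OF r] cj[OF r]])
    finally show "D r = \<kappa> * ?V D r" unfolding VD .
  qed (use r in auto)
  then have fj: "f r = cf / cj * ?j r" if "0 < r" "r < R" for r
    using that cj0 by (simp add: D_def field_simps)
  have "cf / cj * robin R \<kappa> = 0"
  proof -
    obtain r where r: "0 < r" "r < R" using dense[OF R] by blast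
    have "log_kernel_integral R f r = cf / cj * log_kernel_integral R ?j r"
      unfolding log_kernel_integral_def using fj
      by (subst integral_mult_right_zero[symmetric], intro Bochner_Integration.integral_cong) (auto simp: indicator_def)
    then have "cf / cj * ?j r = cf / cj * (?j r - robin R \<kappa>)"
      using eq[OF r] fj[OF r] jeq[OF r] by (simp add: algebra_simps)
    then show ?thesis by (simp add: algebra_simps)
  qed
  then show ?thesis using fj by blast
qed

section \<open>Negativity of the logarithmic form on mean-zero functions\<close>

lemma bounded_kernel_integrable:
  fixes k :: "'a \<Rightarrow> 'b \<Rightarrow> real"
  assumes M: "finite_measure M" and N: "finite_measure N"
    and k: "case_prod k \<in> borel_measurable (M \<Otimes>\<^sub>M N)"
    and bound: "\<And>x y. x \<in> space M \<Longrightarrow> y \<in> space N \<Longrightarrow> \<bar>k x y\<bar> \<le> B"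
    and u: "square_integrable M u" and v: "square_integrable N v"
  shows "integrable (M \<Otimes>\<^sub>M N) (\<lambda>(x, y). k x y * u x * v y)"
proof (rule kernel_integrable[OF M N k _ u v])
  interpret N: finite_measure N by fact
  fix x assume x: "x \<in> space M"
  have "(\<integral>\<^sup>+y. ennreal ((k x y)\<^sup>2) \<partial>N) \<le> (\<integral>\<^sup>+y. ennreal (B\<^sup>2) \<partial>N)"
    using bound[OF x] by (intro nn_integral_mono ennreal_leI) (simp add: abs_le_square_iff[symmetric] order_trans[OF _ abs_ge_self])
  also have "\<dots> = ennreal (B\<^sup>2 * measure N (space N))"
    by (simp add: N.emeasure_eq_measure ennreal_mult)
  finally show "(\<integral>\<^sup>+y. ennreal ((k x y)\<^sup>2) \<partial>N) \<le> ennreal (B\<^sup>2 * measure N (space N))" .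
qed

lemma integral_pair_product:
  fixes f g :: "'a \<Rightarrow> real"
  assumes "finite_measure M" and "square_integrable M f" "square_integrable M g"
  shows "(\<integral>z. f (fst z) * g (snd z) \<partial>(M \<Otimes>\<^sub>M M)) = (\<integral>x. f x \<partial>M) * (\<integral>x. g x \<partial>M)"
proof -
  interpret finite_measure M by fact
  interpret pair_sigma_finite M M ..
  have "integrable (M \<Otimes>\<^sub>M M) (\<lambda>(x, y). 1 * f x * g y)"
    by (rule bounded_kernel_integrable[where B=1]) (use assms in auto)
  then have "integrable (M \<Otimes>\<^sub>M M) (\<lambda>(x, y). f x * g y)" by simp
  from integral_fst[OF this] show ?thesis by (simp add: split_beta')
qed

text \<open>
  One factor \<open>K\<close> can be absorbed in \<open>v\<close>: the form of \<open>K^(k + 1)\<close> at \<open>v\<close> is the sum over \<open>i\<close> of the forms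
  of \<open>K^k\<close> at \<open>f i * v\<close>.
\<close>

lemma gram_kernel_power_nonneg:
  fixes f :: "nat \<Rightarrow> 'a \<Rightarrow> real" and n :: nat
  assumes M: "finite_measure M"
    and fm [measurable]: "\<And>i. f i \<in> borel_measurable M"
    and f1: "\<And>i x. x \<in> space M \<Longrightarrow> \<bar>f i x\<bar> \<le> 1"
  defines "K \<equiv> (\<lambda>x y. \<Sum>i<n. f i x * f i y)"
  assumes v: "square_integrable M v"
  shows "integrable (M \<Otimes>\<^sub>M M) (\<lambda>z. K (fst z) (snd z) ^ k * v (fst z) * v (snd z))"
    and "(\<integral>z. K (fst z) (snd z) ^ k * v (fst z) * v (snd z) \<partial>(M \<Otimes>\<^sub>M M)) \<ge> 0"
proof -
  have Km: "case_prod (\<lambda>x y. K x y ^ k) \<in> borel_measurable (M \<Otimes>\<^sub>M M)" for k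
    unfolding K_def split_beta' by measurable
  have Kb: "\<bar>K x y ^ k\<bar> \<le> real n ^ k" if "x \<in> space M" "y \<in> space M" for x y k
  proof -
    have "\<bar>K x y\<bar> \<le> (\<Sum>i<n. \<bar>f i x\<bar> * \<bar>f i y\<bar>)"
      unfolding K_def by (rule order_trans[OF sum_abs]) (simp add: abs_mult)
    also have "\<dots> \<le> (\<Sum>i<n. 1 * 1)" using f1 that by (intro sum_mono mult_mono) auto
    finally show ?thesis unfolding power_abs by (intro power_mono) auto
  qed
  have int: "integrable (M \<Otimes>\<^sub>M M) (\<lambda>z. K (fst z) (snd z) ^ k * v (fst z) * v (snd z))"
    if "square_integrable M v" for v k
    using bounded_kernel_integrable[OF M M Km Kb that that, of k] by (simp add: split_beta')
  show "integrable (M \<Otimes>\<^sub>M M) (\<lambda>z. K (fst z) (snd z) ^ k * v (fst z) * v (snd z))" by (rule int[OF v])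
  show "(\<integral>z. K (fst z) (snd z) ^ k * v (fst z) * v (snd z) \<partial>(M \<Otimes>\<^sub>M M)) \<ge> 0"
    using v
  proof (induction k arbitrary: v)
    case 0
    then show ?case using integral_pair_product[OF M 0 0] by simp
  next
    case (Suc k)
    have fv: "square_integrable M (\<lambda>x. f i x * v x)" for i
      by (rule square_integrable_bounded_mult[OF Suc.prems fm, where B=1]) (use f1 in auto)
    have "(\<integral>z. K (fst z) (snd z) ^ Suc k * v (fst z) * v (snd z) \<partial>(M \<Otimes>\<^sub>M M))
      = (\<integral>z. (\<Sum>i<n. K (fst z) (snd z) ^ k * (f i (fst z) * v (fst z)) * (f i (snd z) * v (snd z))) \<partial>(M \<Otimes>\<^sub>M M))"
    proof (intro Bochner_Integration.integral_cong refl)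
      have distrib: "c * (\<Sum>i<n. f i a * f i b) * p * q = (\<Sum>i<n. c * (f i a * p) * (f i b * q))" for a b c p q
        by (simp add: sum_distrib_left sum_distrib_right mult_ac)
      have "K a b ^ Suc k * p * q = (\<Sum>i<n. K a b ^ k * (f i a * p) * (f i b * q))" for a b p q
        using distrib[of "K a b ^ k" a b p q] by (simp only: power_Suc2 K_def)
      then show "K (fst z) (snd z) ^ Suc k * v (fst z) * v (snd z)
          = (\<Sum>i<n. K (fst z) (snd z) ^ k * (f i (fst z) * v (fst z)) * (f i (snd z) * v (snd z)))" for z .
    qed
    also have "\<dots> = (\<Sum>i<n. \<integral>z. K (fst z) (snd z) ^ k * (f i (fst z) * v (fst z)) * (f i (snd z) * v (snd z)) \<partial>(M \<Otimes>\<^sub>M M))"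
      by (intro Bochner_Integration.integral_sum int[OF fv])
    also have "\<dots> \<ge> 0" by (intro sum_nonneg Suc.IH fv)
    finally show ?case .
  qed
qed

definition conformal :: "real ^ 2 \<Rightarrow> real" where "conformal x = 1 + (norm x)\<^sup>2"

text \<open>
  Stereographic projection \<open>\<sigma>\<close> onto the unit sphere satisfies \<open>|\<sigma>(x) - \<sigma>(y)|\<^sup>2 = 4 |x - y|\<^sup>2 / (A(x) A(y))\<close>
  with \<open>A = conformal\<close>. These four functions are chosen so that their Gram kernel is
  \<open>|1 + x conj(y)|\<^sup>2 / (A(x) A(y)) = (1 + \<sigma>(x) \<bullet> \<sigma>(y)) / 2\<close>, which has values in \<open>[0, 1]\<close>.
\<close>

definition stereo :: "nat \<Rightarrow> real ^ 2 \<Rightarrow> real" where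
  "stereo i x = (if i = 0 then 1 else if i = 1 then sqrt 2 * x $ 1
      else if i = 2 then sqrt 2 * x $ 2 else (norm x)\<^sup>2) / conformal x"

definition stereo_kernel :: "real ^ 2 \<Rightarrow> real ^ 2 \<Rightarrow> real" where
  "stereo_kernel x y = (\<Sum>i<4. stereo i x * stereo i y)"

lemma norm_sq_2: "(norm (x::real^2))\<^sup>2 = (x $ 1)\<^sup>2 + (x $ 2)\<^sup>2"
  by (simp add: norm_vec_def L2_set_def sum_2)

lemma conformal_ge_1: "conformal x \<ge> 1" by (simp add: conformal_def)

lemma stereo_kernel_eq:
  "stereo_kernel x y = ((1 + x $ 1 * y $ 1 + x $ 2 * y $ 2)\<^sup>2 + (x $ 1 * y $ 2 - x $ 2 * y $ 1)\<^sup>2) / (conformal x * conformal y)"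
proof -
  have sqrt2: "sqrt 2 * a * (sqrt 2 * b) = 2 * (a * b)" for a b :: real by simp
  have "stereo_kernel x y = (1 + 2 * (x $ 1 * y $ 1) + 2 * (x $ 2 * y $ 2) + (norm x)\<^sup>2 * (norm y)\<^sup>2) / (conformal x * conformal y)"
    by (simp add: stereo_kernel_def stereo_def numeral_eq_Suc lessThan_Suc add_divide_distrib sqrt2[unfolded numeral_eq_Suc])
  then show ?thesis unfolding norm_sq_2 by (simp add: power2_eq_square algebra_simps)
qed

text \<open>
  The right hand side is a quarter of the squared chordal distance on the sphere. Its logarithm differs
  from that of \<open>|x - y|\<^sup>2\<close> only by terms that depend on one variable.
\<close>

lemma one_minus_stereo_kernel: "1 - stereo_kernel x y = (norm (x - y))\<^sup>2 / (conformal x * conformal y)"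
proof -
  have "(1 + x $ 1 * y $ 1 + x $ 2 * y $ 2)\<^sup>2 + (x $ 1 * y $ 2 - x $ 2 * y $ 1)\<^sup>2
      = conformal x * conformal y - (norm (x - y))\<^sup>2"
    unfolding conformal_def norm_sq_2 by (simp add: power2_eq_square algebra_simps)
  then show ?thesis
    unfolding stereo_kernel_eq using conformal_ge_1[of x] conformal_ge_1[of y] by (simp add: diff_divide_distrib)
qed

lemma stereo_bound: "\<bar>stereo i x\<bar> \<le> 1"
proof -
  have 1: "\<bar>sqrt 2 * a\<bar> \<le> 1 + (a\<^sup>2 + b\<^sup>2)" for a b :: real
  proof -
    have "0 \<le> (\<bar>a\<bar> * sqrt 2 - 1)\<^sup>2" by simp
    then have "2 * (sqrt 2 * \<bar>a\<bar>) \<le> 2 * a\<^sup>2 + 1" by (simp add: power2_eq_square algebra_simps)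
    moreover have "\<bar>sqrt 2 * a\<bar> = sqrt 2 * \<bar>a\<bar>" by (simp add: abs_mult)
    ultimately show ?thesis using zero_le_power2[of b] by linarith
  qed
  have 2: "\<bar>sqrt 2 * b\<bar> \<le> 1 + (a\<^sup>2 + b\<^sup>2)" for a b :: real using 1[of b a] by (simp add: add.commute)
  have "\<bar>stereo i x * conformal x\<bar> \<le> conformal x"
    using 1[of "x $ 1" "x $ 2"] 2[of "x $ 2" "x $ 1"] conformal_ge_1[of x]
    by (simp add: stereo_def conformal_def norm_sq_2)
  then show ?thesis using conformal_ge_1[of x] by (simp add: abs_mult)
qed

lemma stereo_measurable: "stereo i \<in> borel_measurable borel" "conformal \<in> borel_measurable borel"
proof -
  have c: "continuous_on UNIV conformal" unfolding conformal_def[abs_def] by (intro continuous_intros)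
  then show "conformal \<in> borel_measurable borel" by (rule borel_measurable_continuous_onI)
  have "continuous_on UNIV (stereo i)"
    using c conformal_ge_1 unfolding stereo_def[abs_def]
    by (cases "i = 0"; cases "i = 1"; cases "i = 2") (auto intro!: continuous_intros, (metis not_one_le_zero)+)
  then show "stereo i \<in> borel_measurable borel" by (rule borel_measurable_continuous_onI)
qed

lemma measurable_ln_kernel:
  "(\<lambda>(x, y). ln (norm (x - y :: real^2))) \<in> borel_measurable (lebesgue_on S \<Otimes>\<^sub>M lebesgue_on T)"
  by (intro measurable_pair_lebesgue_on) measurable

lemma ln_kernel_integrable:
  assumes R: "R > 0" and u: "square_integrable (lebesgue_on (ball 0 R)) u"
    and v: "square_integrable (lebesgue_on (ball (0::real^2) R)) v"
  shows "integrable (lebesgue_on (ball 0 R) \<Otimes>\<^sub>M lebesgue_on (ball 0 R)) (\<lambda>(x, y). ln (norm (x - y)) * u x * v y)"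
    and "x \<in> ball 0 R \<Longrightarrow> integrable (lebesgue_on (ball 0 R)) (\<lambda>y. ln (norm (x - y)) * v y)"
proof -
  obtain C where C: "\<And>x. x \<in> ball (0::real^2) R \<Longrightarrow>
      (\<integral>\<^sup>+y. ennreal ((ln (norm (x - y)))\<^sup>2) \<partial>lebesgue_on (ball 0 R)) \<le> ennreal C"
    using nn_integral_ln_kernel_bound[OF R] by blast
  show "integrable (lebesgue_on (ball 0 R) \<Otimes>\<^sub>M lebesgue_on (ball 0 R)) (\<lambda>(x, y). ln (norm (x - y)) * u x * v y)"
    by (rule kernel_integrable[OF finite_measure_disc finite_measure_disc measurable_ln_kernel _ u v]) (use C in auto)
  have "(\<lambda>y. ln (norm (x - y))) \<in> borel_measurable (lebesgue_on (ball 0 R))"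
    by (intro measurable_lebesgue_on_borel) measurable
  then show "x \<in> ball 0 R \<Longrightarrow> integrable (lebesgue_on (ball 0 R)) (\<lambda>y. ln (norm (x - y)) * v y)"
    using kernel_integrable_section[OF _ C v] by blast
qed

lemma AE_disc_pair_neq:
  "AE z in lebesgue_on (ball (0::real^2) R) \<Otimes>\<^sub>M lebesgue_on (ball (0::real^2) R). fst z \<noteq> snd z"
proof -
  let ?M = "lebesgue_on (ball (0::real^2) R)"
  interpret finite_measure ?M by (rule finite_measure_disc)
  interpret pair_sigma_finite ?M ?M ..
  have "(\<lambda>z. norm (fst z - snd z)) \<in> borel_measurable (?M \<Otimes>\<^sub>M ?M)"
    by (intro measurable_pair_lebesgue_on) measurable
  then have "{z \<in> space (?M \<Otimes>\<^sub>M ?M). norm (fst z - snd z) \<noteq> 0} \<in> sets (?M \<Otimes>\<^sub>M ?M)" by measurable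
  moreover have "AE y in ?M. x \<noteq> y" for x
  proof -
    have "{x} \<in> null_sets lebesgue" by (simp add: null_sets_completionI)
    then have "AE y in lebesgue. y \<notin> {x}" by (rule AE_not_in)
    then show ?thesis by (subst AE_restrict_space_iff) (auto elim: eventually_mono)
  qed
  ultimately show ?thesis by (intro AE_pair_measure) auto
qed

text \<open>
  For mean-zero \<open>v\<close> the one-variable terms integrate to zero, which leaves the form of
  \<open>ln (1 - K) = - \<Sum> K\<^sup>n / n\<close> with \<open>K = stereo_kernel\<close>. The partial sums have forms of the right sign and
  are dominated by the limit since \<open>K \<ge> 0\<close>.
\<close>

lemma ln_form_nonpos:
  assumes R: "R > 0" and v: "square_integrable (lebesgue_on (ball (0::real^2) R)) v"
    and mean: "(\<integral>x. v x \<partial>lebesgue_on (ball 0 R)) = 0"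
  shows "(\<integral>z. ln (norm (fst z - snd z)) * v (fst z) * v (snd z)
      \<partial>(lebesgue_on (ball 0 R) \<Otimes>\<^sub>M lebesgue_on (ball 0 R))) \<le> 0"
proof -
  let ?M = "lebesgue_on (ball (0::real^2) R)"
  let ?P = "?M \<Otimes>\<^sub>M ?M"
  have fM: "finite_measure ?M" by (rule finite_measure_disc)
  let ?K = "\<lambda>z. stereo_kernel (fst z) (snd z)"
  let ?vv = "\<lambda>z. v (fst z) * v (snd z)"
  have stm [measurable]: "stereo i \<in> borel_measurable ?M" for i
    by (intro measurable_lebesgue_on_borel stereo_measurable)
  have [measurable]: "conformal \<in> borel_measurable ?M"
    by (intro measurable_lebesgue_on_borel stereo_measurable)
  have vm [measurable]: "v \<in> borel_measurable ?M" using v by (simp add: square_integrable_def)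
  have one: "square_integrable ?M (\<lambda>_. 1)"
    by (rule square_integrable_bounded[OF fM, where B=1]) auto
  have pow: "integrable ?P (\<lambda>z. ?K z ^ k * v (fst z) * v (snd z))"
    "(\<integral>z. ?K z ^ k * v (fst z) * v (snd z) \<partial>?P) \<ge> 0" for k
    using gram_kernel_power_nonneg[where f=stereo and n=4, OF fM stm stereo_bound v]
    unfolding stereo_kernel_def by blast+
  have i0: "integrable ?P (\<lambda>z. ln (norm (fst z - snd z)) * ?vv z)"
    using ln_kernel_integrable(1)[OF R v v] by (simp add: split_beta' mult.assoc)
  have lnc: "\<bar>ln (conformal x)\<bar> \<le> R\<^sup>2" if "x \<in> space ?M" for x
  proof -
    have "ln (conformal x) \<le> (norm x)\<^sup>2" unfolding conformal_def by (rule ln_add_one_self_le_self) auto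
    also have "\<dots> \<le> R\<^sup>2" using that by (intro power_mono) auto
    finally show ?thesis using conformal_ge_1[of x] by (simp add: abs_le_iff)
  qed
  have lv: "square_integrable ?M (\<lambda>x. ln (conformal x) * v x)"
    by (rule square_integrable_bounded_mult[OF v, where B="R\<^sup>2"]) (use lnc in auto)
  have prod: "integrable ?P (\<lambda>z. f (fst z) * g (snd z))" if "square_integrable ?M f" "square_integrable ?M g" for f g
    using bounded_kernel_integrable[OF fM fM _ _ that, of "\<lambda>_ _. 1" 1] by (simp add: split_beta')
  let ?L = "\<lambda>z. - ln (1 - ?K z) * ?vv z"
  have L_AE: "AE z in ?P. ?L z = ln (conformal (fst z)) * v (fst z) * v (snd z)
      + v (fst z) * (ln (conformal (snd z)) * v (snd z)) - 2 * (ln (norm (fst z - snd z)) * ?vv z)"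
    using AE_disc_pair_neq
  proof eventually_elim
    case (elim z)
    have eq: "ln (1 - ?K z) = 2 * ln (norm (fst z - snd z)) - ln (conformal (fst z)) - ln (conformal (snd z))"
      using elim conformal_ge_1[of "fst z"] conformal_ge_1[of "snd z"]
      by (simp add: one_minus_stereo_kernel ln_div ln_mult ln_realpow)
    show ?case unfolding eq by (simp add: algebra_simps)
  qed
  have Lm [measurable]: "?L \<in> borel_measurable ?P" unfolding stereo_kernel_def by measurable
  have iL: "integrable ?P ?L"
  proof (rule integrable_cong_AE_imp[OF _ Lm])
    show "integrable ?P (\<lambda>z. ln (conformal (fst z)) * v (fst z) * v (snd z)
      + v (fst z) * (ln (conformal (snd z)) * v (snd z)) - 2 * (ln (norm (fst z - snd z)) * ?vv z))"
      using prod[OF lv v] prod[OF v lv] i0 by (intro Bochner_Integration.integrable_diff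
          Bochner_Integration.integrable_add integrable_mult_right) auto
    show "AE z in ?P. ln (conformal (fst z)) * v (fst z) * v (snd z)
      + v (fst z) * (ln (conformal (snd z)) * v (snd z)) - 2 * (ln (norm (fst z - snd z)) * ?vv z) = ?L z"
      using L_AE by eventually_elim (rule sym)
  qed
  have vL: "(\<integral>z. ?L z \<partial>?P) = - 2 * (\<integral>z. ln (norm (fst z - snd z)) * ?vv z \<partial>?P)"
  proof -
    have "(\<integral>z. ?L z \<partial>?P) = (\<integral>z. (ln (conformal (fst z)) * v (fst z)) * v (snd z)
      + v (fst z) * (ln (conformal (snd z)) * v (snd z)) - 2 * (ln (norm (fst z - snd z)) * ?vv z) \<partial>?P)"
    proof (rule integral_cong_AE[OF Lm _ L_AE])
      have [measurable]: "(\<lambda>z. ln (norm (fst z - snd z)) * ?vv z) \<in> borel_measurable ?P"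
        by (rule borel_measurable_integrable[OF i0])
      show "(\<lambda>z. ln (conformal (fst z)) * v (fst z) * v (snd z)
          + v (fst z) * (ln (conformal (snd z)) * v (snd z)) - 2 * (ln (norm (fst z - snd z)) * ?vv z)) \<in> borel_measurable ?P"
        by measurable
    qed
    also have "\<dots> = (\<integral>x. ln (conformal x) * v x \<partial>?M) * 0 + 0 * (\<integral>x. ln (conformal x) * v x \<partial>?M)
        - 2 * (\<integral>z. ln (norm (fst z - snd z)) * ?vv z \<partial>?P)"
      using prod[OF lv v] prod[OF v lv] i0
      by (simp add: integral_pair_product[OF fM lv v] integral_pair_product[OF fM v lv] mean)
    finally show ?thesis by simp
  qed
  let ?S = "\<lambda>N z. (\<Sum>n<N. ?K z ^ n / real n) * ?vv z"
  have "(\<lambda>N. \<integral>z. ?S N z \<partial>?P) \<longlonglongrightarrow> (\<integral>z. ?L z \<partial>?P)"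
  proof (rule integral_dominated_convergence[where w="\<lambda>z. norm (?L z)"])
    show "?S N \<in> borel_measurable ?P" for N unfolding stereo_kernel_def by measurable
    have K01: "0 \<le> ?K z" "?K z < 1" if "fst z \<noteq> snd z" for z
    proof -
      show "0 \<le> ?K z" using conformal_ge_1[of "fst z"] conformal_ge_1[of "snd z"] by (simp add: stereo_kernel_eq)
      have "0 < 1 - ?K z" unfolding one_minus_stereo_kernel
        using that conformal_ge_1[of "fst z"] conformal_ge_1[of "snd z"] by (intro divide_pos_pos mult_pos_pos) auto
      then show "?K z < 1" by simp
    qed
    have sums: "(\<lambda>n. ?K z ^ n / real n) sums (- ln (1 - ?K z))" if "fst z \<noteq> snd z" for z
      using sums_minus[OF ln_series'[of "- ?K z"]] K01[OF that] by simp
    show "AE z in ?P. (\<lambda>N. ?S N z) \<longlonglongrightarrow> ?L z"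
      using AE_disc_pair_neq by eventually_elim (intro tendsto_mult_right sums[unfolded sums_def])
    show "AE z in ?P. norm (?S N z) \<le> norm (?L z)" for N
      using AE_disc_pair_neq
    proof eventually_elim
      case (elim z)
      have "(\<Sum>n<N. ?K z ^ n / real n) \<le> - ln (1 - ?K z)"
        unfolding sums_unique[OF sums[OF elim]]
        using K01[OF elim] by (intro sum_le_suminf sums_summable[OF sums[OF elim]]) auto
      moreover have "(\<Sum>n<N. ?K z ^ n / real n) \<ge> 0" using K01[OF elim] by (intro sum_nonneg) auto
      ultimately show ?case unfolding norm_mult by (intro mult_right_mono) auto
    qed
  qed (use iL in auto)
  moreover have "(\<integral>z. ?S N z \<partial>?P) \<ge> 0" for N
  proof -
    have "(\<integral>z. ?S N z \<partial>?P) = (\<integral>z. (\<Sum>n<N. (?K z ^ n * v (fst z) * v (snd z)) / real n) \<partial>?P)"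
      by (intro Bochner_Integration.integral_cong) (auto simp: sum_distrib_right mult.assoc)
    also have "\<dots> = (\<Sum>n<N. (\<integral>z. ?K z ^ n * v (fst z) * v (snd z) \<partial>?P) / real n)"
      using pow(1) by (subst Bochner_Integration.integral_sum) auto
    also have "\<dots> \<ge> 0" using pow(2) by (intro sum_nonneg) auto
    finally show ?thesis .
  qed
  ultimately have "(\<integral>z. ?L z \<partial>?P) \<ge> 0" by (intro LIMSEQ_le_const) auto
  then show ?thesis unfolding vL by (simp add: mult.assoc)
qed

section \<open>Eigenfunctions of the logarithmic potential\<close>

lemma L2_iff: "u \<in> L2 \<Omega> \<longleftrightarrow> square_integrable (lebesgue_on \<Omega>) u"
  by (simp add: L2_def square_integrable_def)

lemma log_potential_eq:
  "log_potential \<Omega> u x = - (\<integral>y. ln (norm (x - y)) * u y \<partial>lebesgue_on \<Omega>) / (2 * pi)"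
proof -
  have "ln (1 / norm (x - y)) = - ln (norm (x - y))" for y
    by (cases "x = y") (auto simp: ln_div)
  then show ?thesis by (simp add: log_potential_def)
qed

lemma eigenfunction_iff:
  "eigenfunction \<Omega> \<tau> u \<longleftrightarrow> square_integrable (lebesgue_on \<Omega>) u \<and> \<not> (AE x in lebesgue_on \<Omega>. u x = 0) \<and>
    (AE x in lebesgue_on \<Omega>. (\<integral>y. ln (norm (x - y)) * u y \<partial>lebesgue_on \<Omega>) = - (2 * pi * \<tau>) * u x)"
proof -
  have "log_potential \<Omega> u x = \<tau> * u x \<longleftrightarrow>
      (\<integral>y. ln (norm (x - y)) * u y \<partial>lebesgue_on \<Omega>) = - (2 * pi * \<tau>) * u x" for x
    unfolding log_potential_eq by (auto simp: field_simps)
  then show ?thesis by (simp only: eigenfunction_def L2_iff)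
qed

text \<open>
  Completeness of Lebesgue measure; eigenfunctions are only determined almost everywhere.
\<close>

lemma borel_measurable_lebesgue_on_AE:
  fixes f g :: "'a::euclidean_space \<Rightarrow> real"
  assumes S: "S \<in> sets lebesgue" and f: "f \<in> borel_measurable (lebesgue_on S)"
    and ae: "AE x in lebesgue_on S. f x = g x"
  shows "g \<in> borel_measurable (lebesgue_on S)"
proof -
  have "(\<lambda>x. if x \<in> S then f x else 0) \<in> borel_measurable lebesgue"
    using f S by (simp add: borel_measurable_if)
  moreover have "AE x in lebesgue. (if x \<in> S then f x else 0) = (if x \<in> S then g x else 0)"
    using ae S by (subst (asm) AE_restrict_space_iff) (auto elim: eventually_mono)
  ultimately have "(\<lambda>x. if x \<in> S then g x else 0) \<in> borel_measurable lebesgue"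
    by (rule borel_measurable_AE)
  then show ?thesis using S by (simp add: borel_measurable_if)
qed

lemma square_integrable_bess: "square_integrable (lebesgue_on (ball (0::real^2) R)) (\<lambda>x. bess \<kappa> (norm x))"
proof -
  obtain B where B: "\<forall>s\<in>{0..R}. \<bar>bess \<kappa> s\<bar> \<le> B" using bess_bounded by blast
  have "(\<lambda>x::real^2. bess \<kappa> (norm x)) \<in> borel_measurable (lebesgue_on (ball 0 R))"
    by (intro measurable_lebesgue_on_borel) measurable
  then show ?thesis
    by (rule square_integrable_bounded[OF finite_measure_disc, where B=B]) (use B in auto)
qed

lemma bess_norm_not_AE_zero:
  assumes "R > 0"
  shows "\<not> (AE x in lebesgue_on (ball (0::real^2) R). bess \<kappa> (norm x) = 0)"
proof
  assume ae: "AE x in lebesgue_on (ball (0::real^2) R). bess \<kappa> (norm x) = 0"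
  obtain d where d: "d > 0" "\<And>r. \<bar>r\<bar> < d \<Longrightarrow> \<bar>bess \<kappa> r - 1\<bar> < 1"
    using continuous_bess[of UNIV \<kappa>, unfolded continuous_on_iff, rule_format, of 0 1]
    by (auto simp: dist_real_def)
  define e where "e = min d R"
  have e: "0 < e" "e \<le> d" "e \<le> R" using d assms by (auto simp: e_def)
  have sub: "ball (0::real^2) e \<subseteq> ball 0 R" using e by auto
  have "AE x in lebesgue_on (ball (0::real^2) R). x \<notin> ball 0 e"
    using ae
  proof eventually_elim
    case (elim x)
    then show ?case using d(2)[of "norm x"] e(2) by auto
  qed
  moreover have "ball (0::real^2) e \<in> sets (lebesgue_on (ball 0 R))" using sub by (auto simp: sets_disc)
  ultimately have "ball (0::real^2) e \<in> null_sets (lebesgue_on (ball 0 R))" by (simp add: AE_iff_null_sets)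
  then have "emeasure lebesgue (ball (0::real^2) e) = 0"
    using sub by (simp add: null_sets_def emeasure_restrict_space)
  then show False using e emeasure_disc(1)[of e] by simp
qed

lemma ln_potential_radial_polar:
  assumes R: "R > 0" and f [measurable]: "f \<in> borel_measurable borel"
  shows "(\<integral>y. ln (max r (norm y)) * f (norm y) \<partial>lebesgue_on (ball (0::real^2) R)) = 2 * pi * log_kernel_integral R f r"
proof -
  have "(\<integral>y. ln (max r (norm y)) * f (norm y) \<partial>lebesgue_on (ball (0::real^2) R))
      = (\<integral>s. radius_density R s * (ln (max r s) * f s) \<partial>lborel)"
    using integral_disc_norm[OF R, of "\<lambda>s. ln (max r s) * f s"] by simp
  also have "\<dots> = (\<integral>s. 2 * pi * (indicator {0<..<R} s * (s * ln (max r s) * f s)) \<partial>lborel)"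
    by (intro Bochner_Integration.integral_cong) (auto simp: radius_density_def)
  finally show ?thesis by (simp add: log_kernel_integral_def)
qed

lemma AE_disc: "AE x in lebesgue_on (ball (0::real^2) R). 0 < norm x \<and> norm x < R"
proof -
  have "AE x in lebesgue_on (ball (0::real^2) R). x \<in> space (lebesgue_on (ball (0::real^2) R))" by (rule AE_space)
  with AE_disc_norm_neq[where R=R and r=0] show ?thesis by eventually_elim auto
qed

text \<open>
  The eigenvalue is \<open>- 1 / \<kappa>\<close> because the potential operator inverts \<open>- \<Delta>\<close>, up to a term that the
  boundary condition removes.
\<close>

lemma bess_eigenfunction:
  assumes R: "R > 0" and \<kappa>: "\<kappa> \<noteq> 0" and bc: "robin R \<kappa> = 0" and c: "c \<noteq> 0"
    and u: "AE x in lebesgue_on (ball 0 R). u x = c * bess \<kappa> (norm x)"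
  shows "radial_eigenfunction R (- 1 / \<kappa>) u"
proof -
  let ?M = "lebesgue_on (ball (0::real^2) R)"
  let ?w = "\<lambda>x::real^2. bess \<kappa> (norm x)"
  have wsq: "square_integrable ?M ?w" by (rule square_integrable_bess)
  have cw: "square_integrable ?M (\<lambda>x. c * ?w x)"
    using square_integrable_lincomb[OF wsq wsq, of c 0] by simp
  have um [measurable]: "u \<in> borel_measurable ?M"
    by (rule borel_measurable_lebesgue_on_AE[where f="\<lambda>x. c * ?w x"])
      (use cw u in \<open>auto simp: square_integrable_def elim: eventually_mono\<close>)
  have "integrable ?M (\<lambda>x. (u x)\<^sup>2)"
    by (rule integrable_cong_AE_imp[where g="\<lambda>x. (c * ?w x)\<^sup>2"])
      (use cw u in \<open>auto simp: square_integrable_def elim: eventually_mono\<close>)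
  then have usq: "square_integrable ?M u" by (simp add: square_integrable_def)
  have nz: "\<not> (AE x in ?M. u x = 0)"
  proof
    assume "AE x in ?M. u x = 0"
    with u have "AE x in ?M. ?w x = 0" by eventually_elim (use c in simp)
    then show False using bess_norm_not_AE_zero[OF R] by blast
  qed
  have lnm [measurable]: "(\<lambda>y. ln (norm (x - y))) \<in> borel_measurable ?M" for x
    by (intro measurable_lebesgue_on_borel) measurable
  have [measurable]: "?w \<in> borel_measurable ?M" using wsq by (simp add: square_integrable_def)
  have "AE x in ?M. (\<integral>y. ln (norm (x - y)) * u y \<partial>?M) = - (2 * pi * (- 1 / \<kappa>)) * u x"
    using AE_disc u
  proof eventually_elim
    case (elim x)
    have "(\<integral>y. ln (norm (x - y)) * u y \<partial>?M) = (\<integral>y. c * (ln (norm (x - y)) * ?w y) \<partial>?M)"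
    proof (rule integral_cong_AE)
      show "AE y in ?M. ln (norm (x - y)) * u y = c * (ln (norm (x - y)) * ?w y)"
        using u by eventually_elim simp
    qed measurable
    also have "\<dots> = c * (\<integral>y. ln (norm (x - y)) * ?w y \<partial>?M)" by simp
    also have "(\<integral>y. ln (norm (x - y)) * ?w y \<partial>?M) = (\<integral>y. ln (max (norm x) (norm y)) * ?w y \<partial>?M)"
      using elim by (intro radial_ln_potential[OF R wsq, where g="bess \<kappa>"]) auto
    also have "\<dots> = 2 * pi * ((bess \<kappa> (norm x) - robin R \<kappa>) / \<kappa>)"
      using elim by (simp add: ln_potential_radial_polar[OF R] log_kernel_integral_bess \<kappa>)
    finally show ?case using elim bc by simp
  qed
  moreover have "radial_on (ball 0 R) u"
    unfolding radial_on_def using u by (intro exI[of _ "\<lambda>s. c * bess \<kappa> s"])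
  ultimately show ?thesis unfolding radial_eigenfunction_def eigenfunction_iff using usq nz by blast
qed

lemma square_integrable_ln_norm:
  assumes "R > 0"
  shows "square_integrable (lebesgue_on (ball (0::real^2) R)) (\<lambda>y. ln (norm y))"
proof -
  have "(\<lambda>y::real^2. ln (norm y)) \<in> borel_measurable (lebesgue_on (ball 0 R))"
    by (intro measurable_lebesgue_on_borel) measurable
  then show ?thesis using nn_integral_ln_norm_sq_finite[OF assms] by (simp add: square_integrable_iff_nn)
qed

text \<open>
  The potential of \<open>u\<close> is defined by an integral at every radius, so dividing it by \<open>\<tau>\<close> gives a
  representative \<open>\<Phi>(|x|)\<close> of \<open>u\<close> that is Borel measurable, bounded, and solves the radial integral
  equation pointwise.
\<close>

lemma radial_eigenfunction_bess:
  assumes R: "R > 0" and \<tau>: "\<tau> \<noteq> 0" and u: "radial_eigenfunction R \<tau> u"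
  shows "robin R (- 1 / \<tau>) = 0"
    and "\<exists>c. c \<noteq> 0 \<and> (AE x in lebesgue_on (ball 0 R). u x = c * bess (- 1 / \<tau>) (norm x))"
proof -
  let ?M = "lebesgue_on (ball (0::real^2) R)"
  define \<kappa> where "\<kappa> = - 1 / \<tau>"
  have \<kappa>: "\<kappa> \<noteq> 0" using \<tau> by (simp add: \<kappa>_def)
  interpret finite_measure ?M by (rule finite_measure_disc)
  have usq: "square_integrable ?M u" and nz: "\<not> (AE x in ?M. u x = 0)"
    and eig: "AE x in ?M. (\<integral>y. ln (norm (x - y)) * u y \<partial>?M) = - (2 * pi * \<tau>) * u x"
    and "radial_on (ball 0 R) u"
    using u by (auto simp: radial_eigenfunction_def eigenfunction_iff)
  then obtain g where g: "AE x in ?M. u x = g (norm x)" by (auto simp: radial_on_def)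
  have um [measurable]: "u \<in> borel_measurable ?M" using usq by (simp add: square_integrable_def)
  have nm [measurable]: "norm \<in> borel_measurable ?M" by (intro measurable_lebesgue_on_borel) measurable
  define \<Phi> where "\<Phi> = (\<lambda>r. \<kappa> / (2 * pi) * (\<integral>y. ln (max r (norm y)) * u y \<partial>?M))"
  have \<Phi>m [measurable]: "\<Phi> \<in> borel_measurable borel"
    unfolding \<Phi>_def by measurable
  have u\<Phi>: "AE x in ?M. u x = \<Phi> (norm x)"
    using AE_disc eig
  proof eventually_elim
    case (elim x)
    have "(\<integral>y. ln (norm (x - y)) * u y \<partial>?M) = (\<integral>y. ln (max (norm x) (norm y)) * u y \<partial>?M)"
      using elim by (intro radial_ln_potential[OF R usq g]) auto
    then have "(\<integral>y. ln (max (norm x) (norm y)) * u y \<partial>?M) = - (2 * pi * \<tau>) * u x"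
      using elim by simp
    then show ?case using \<tau> by (simp add: \<Phi>_def \<kappa>_def)
  qed
  let ?B = "\<integral>y. (ln (norm y))\<^sup>2 + (ln R)\<^sup>2 + (u y)\<^sup>2 \<partial>?M"
  have iB: "integrable ?M (\<lambda>y. (ln (norm y))\<^sup>2 + (ln R)\<^sup>2 + (u y)\<^sup>2)"
    using square_integrable_ln_norm[OF R] usq by (simp add: square_integrable_def)
  have bound: "\<bar>\<Phi> r\<bar> \<le> \<bar>\<kappa> / (2 * pi)\<bar> * ?B" if r: "0 < r" "r < R" for r
  proof -
    have "AE y in ?M. \<bar>ln (max r (norm y)) * u y\<bar> \<le> (ln (norm y))\<^sup>2 + (ln R)\<^sup>2 + (u y)\<^sup>2"
      using AE_disc
    proof eventually_elim
      case (elim y)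
      have "(ln (max r (norm y)))\<^sup>2 \<le> (ln (norm y))\<^sup>2 + (ln R)\<^sup>2"
      proof (cases "norm y \<le> r \<and> ln r \<ge> 0")
        case True
        then have "(ln r)\<^sup>2 \<le> (ln R)\<^sup>2" using r by (intro power_mono) auto
        then show ?thesis using True by (simp add: max_def add_increasing)
      next
        case False
        have "(ln (max r (norm y)))\<^sup>2 \<le> (ln (norm y))\<^sup>2"
        proof (cases "norm y \<le> r")
          case True
          then have "ln (norm y) \<le> ln r" "ln r < 0" using elim False r by (auto intro: ln_mono)
          then have "(- ln r)\<^sup>2 \<le> (- ln (norm y))\<^sup>2" by (intro power_mono) auto
          then show ?thesis using True by (simp add: max_def)
        qed (simp add: max_def)
        then show ?thesis by (simp add: add_increasing2)
      qed
      moreover have "\<bar>ln (max r (norm y)) * u y\<bar> \<le> (ln (max r (norm y)))\<^sup>2 + (u y)\<^sup>2"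
        using sum_squares_bound[of "\<bar>ln (max r (norm y))\<bar>" "\<bar>u y\<bar>"]
          mult_nonneg_nonneg[of "\<bar>ln (max r (norm y))\<bar>" "\<bar>u y\<bar>"]
        unfolding abs_mult power2_abs by linarith
      ultimately show ?case by linarith
    qed
    moreover from this have "integrable ?M (\<lambda>y. ln (max r (norm y)) * u y)"
      by (intro Bochner_Integration.integrable_bound[OF iB]) (auto elim!: eventually_mono)
    ultimately have "(\<integral>y. \<bar>ln (max r (norm y)) * u y\<bar> \<partial>?M) \<le> ?B"
      by (intro integral_mono_AE iB) auto
    then have "\<bar>\<integral>y. ln (max r (norm y)) * u y \<partial>?M\<bar> \<le> ?B"
      using integral_abs_bound[of ?M "\<lambda>y. ln (max r (norm y)) * u y"] by linarith
    then show ?thesis unfolding \<Phi>_def abs_mult[of "\<kappa> / (2 * pi)"] by (intro mult_left_mono) auto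
  qed
  have eq: "\<Phi> r = \<kappa> * log_kernel_integral R \<Phi> r" if "0 < r" "r < R" for r
  proof -
    have "(\<integral>y. ln (max r (norm y)) * u y \<partial>?M) = (\<integral>y. ln (max r (norm y)) * \<Phi> (norm y) \<partial>?M)"
    proof (rule integral_cong_AE)
      show "AE y in ?M. ln (max r (norm y)) * u y = ln (max r (norm y)) * \<Phi> (norm y)"
        using u\<Phi> by eventually_elim simp
    qed measurable
    then have "\<Phi> r = \<kappa> / (2 * pi) * (2 * pi * log_kernel_integral R \<Phi> r)"
      unfolding ln_potential_radial_polar[OF R \<Phi>m] by (simp add: \<Phi>_def)
    then show ?thesis by simp
  qed
  obtain c where c: "\<And>r. 0 < r \<Longrightarrow> r < R \<Longrightarrow> \<Phi> r = c * bess \<kappa> r" "c * robin R \<kappa> = 0"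
    using log_kernel_solution_bess[OF R \<kappa> \<Phi>m bound eq] by blast
  have uc: "AE x in ?M. u x = c * bess \<kappa> (norm x)"
    using AE_disc u\<Phi> by eventually_elim (simp add: c(1))
  have "c \<noteq> 0" using uc nz by auto
  then show "robin R (- 1 / \<tau>) = 0"
    "\<exists>c. c \<noteq> 0 \<and> (AE x in ?M. u x = c * bess (- 1 / \<tau>) (norm x))"
    using c(2) uc unfolding \<kappa>_def by auto
qed

lemma radial_eigenfunction_iff:
  assumes "R > 0" "\<tau> \<noteq> 0"
  shows "radial_eigenfunction R \<tau> u \<longleftrightarrow> robin R (- 1 / \<tau>) = 0 \<and>
    (\<exists>c. c \<noteq> 0 \<and> (AE x in lebesgue_on (ball 0 R). u x = c * bess (- 1 / \<tau>) (norm x)))"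
  using radial_eigenfunction_bess[OF assms] bess_eigenfunction[OF assms(1), of "- 1 / \<tau>"] assms(2) by auto

lemma radial_eigenvalue_iff:
  assumes "R > 0" "\<tau> \<noteq> 0"
  shows "radial_eigenvalue R \<tau> \<longleftrightarrow> robin R (- 1 / \<tau>) = 0"
proof
  assume "robin R (- 1 / \<tau>) = 0"
  then have "radial_eigenfunction R \<tau> (\<lambda>x. bess (- 1 / \<tau>) (norm x))"
    unfolding radial_eigenfunction_iff[OF assms] by (intro conjI exI[of _ 1]) auto
  then show "radial_eigenvalue R \<tau>" by (auto simp: radial_eigenvalue_def)
qed (auto simp: radial_eigenvalue_def radial_eigenfunction_iff[OF assms])

text \<open>
  The two iterated integrals of the form; together they say that the operator is symmetric.
\<close>

lemma ln_form_eq: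
  assumes R: "R > 0"
    and u: "square_integrable (lebesgue_on (ball (0::real^2) R)) u"
    and v: "square_integrable (lebesgue_on (ball (0::real^2) R)) v"
  shows "(\<integral>z. ln (norm (fst z - snd z)) * u (fst z) * v (snd z) \<partial>(lebesgue_on (ball 0 R) \<Otimes>\<^sub>M lebesgue_on (ball 0 R)))
      = (\<integral>x. (\<integral>y. ln (norm (x - y)) * v y \<partial>lebesgue_on (ball 0 R)) * u x \<partial>lebesgue_on (ball 0 R))" (is ?fst)
    and "(\<integral>z. ln (norm (fst z - snd z)) * u (fst z) * v (snd z) \<partial>(lebesgue_on (ball 0 R) \<Otimes>\<^sub>M lebesgue_on (ball 0 R)))
      = (\<integral>x. (\<integral>y. ln (norm (x - y)) * u y \<partial>lebesgue_on (ball 0 R)) * v x \<partial>lebesgue_on (ball 0 R))" (is ?snd)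
proof -
  let ?M = "lebesgue_on (ball (0::real^2) R)"
  interpret finite_measure ?M by (rule finite_measure_disc)
  interpret pair_sigma_finite ?M ?M ..
  have int: "integrable (?M \<Otimes>\<^sub>M ?M) (\<lambda>(x, y). ln (norm (x - y)) * u x * v y)"
    by (rule ln_kernel_integrable[OF R u v])
  have *: "(\<integral>y. ln (norm (x - y)) * u x * v y \<partial>?M) = (\<integral>y. ln (norm (x - y)) * v y \<partial>?M) * u x" for x
    by (subst integral_mult_left_zero[symmetric]) (simp add: mult_ac)
  show ?fst using integral_fst[OF int] by (simp add: * split_beta')
  have *: "(\<integral>x. ln (norm (x - y)) * u x * v y \<partial>?M) = (\<integral>x. ln (norm (y - x)) * u x \<partial>?M) * v y" for y
    by (simp add: norm_minus_commute)
  show ?snd using integral_snd[OF int] unfolding * by (simp add: split_beta')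
qed

text \<open>
  The combination \<open>v = b u - a w\<close>, with \<open>a\<close> and \<open>b\<close> the integrals of \<open>u\<close> and \<open>w\<close>, has mean zero, so its
  quadratic form has the wrong sign for a combination of eigenfunctions with negative eigenvalues. For
  different eigenvalues, \<open>u\<close> and \<open>w\<close> are orthogonal and the form would be negative; for equal ones it is
  the eigenvalue times \<open>\<integral> v\<^sup>2\<close>, which forces \<open>v = 0\<close>.
\<close>

lemma negative_eigenfunctions_proportional:
  assumes R: "R > 0" and \<sigma>: "\<sigma> < 0" and \<tau>: "\<tau> < 0"
    and w: "eigenfunction (ball 0 R) \<sigma> w" and u: "eigenfunction (ball 0 R) \<tau> u"
  shows "\<tau> = \<sigma> \<and> (\<exists>c. AE x in lebesgue_on (ball 0 R). u x = c * w x)"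
proof -
  let ?M = "lebesgue_on (ball (0::real^2) R)"
  have fM: "finite_measure ?M" by (rule finite_measure_disc)
  have usq: "square_integrable ?M u" and unz: "\<not> (AE x in ?M. u x = 0)"
    and ueig: "AE x in ?M. (\<integral>y. ln (norm (x - y)) * u y \<partial>?M) = - (2 * pi * \<tau>) * u x"
    using u by (auto simp: eigenfunction_iff)
  have wsq: "square_integrable ?M w" and wnz: "\<not> (AE x in ?M. w x = 0)"
    and weig: "AE x in ?M. (\<integral>y. ln (norm (x - y)) * w y \<partial>?M) = - (2 * pi * \<sigma>) * w x"
    using w by (auto simp: eigenfunction_iff)
  have [measurable]: "u \<in> borel_measurable ?M" "w \<in> borel_measurable ?M"
    using usq wsq by (auto simp: square_integrable_def)
  have [measurable]: "(\<lambda>x. \<integral>y. ln (norm (x - y)) * f y \<partial>?M) \<in> borel_measurable ?M"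
    if [measurable]: "f \<in> borel_measurable ?M" for f
  proof -
    interpret finite_measure ?M by (rule fM)
    have [measurable]: "(\<lambda>(x, y). ln (norm (x - y))) \<in> borel_measurable (?M \<Otimes>\<^sub>M ?M)"
      by (rule measurable_ln_kernel)
    have "(\<lambda>(x, y). ln (norm (x - y)) * f y) \<in> borel_measurable (?M \<Otimes>\<^sub>M ?M)"
      using measurable_ln_kernel[of "ball 0 R" "ball 0 R"] unfolding split_beta' by measurable
    then show ?thesis by (rule borel_measurable_lebesgue_integral)
  qed
  define uu where "uu = (\<integral>x. (u x)\<^sup>2 \<partial>?M)"
  define ww where "ww = (\<integral>x. (w x)\<^sup>2 \<partial>?M)"
  define uw where "uw = (\<integral>x. u x * w x \<partial>?M)"
  define a where "a = (\<integral>x. u x \<partial>?M)"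
  define b where "b = (\<integral>x. w x \<partial>?M)"
  have iuu: "integrable ?M (\<lambda>x. (u x)\<^sup>2)" and iww: "integrable ?M (\<lambda>x. (w x)\<^sup>2)"
    using usq wsq by (auto simp: square_integrable_def)
  have iuw: "integrable ?M (\<lambda>x. u x * w x)" by (rule square_integrable_mult[OF usq wsq])
  have pos: "uu > 0" "ww > 0"
  proof -
    have "uu \<noteq> 0" unfolding uu_def using integral_nonneg_eq_0_iff_AE[OF iuu] unz by auto
    moreover have "ww \<noteq> 0" unfolding ww_def using integral_nonneg_eq_0_iff_AE[OF iww] wnz by auto
    moreover have "uu \<ge> 0" "ww \<ge> 0" by (auto simp: uu_def ww_def)
    ultimately show "uu > 0" "ww > 0" by auto
  qed
  have sym: "\<tau> * uw = \<sigma> * uw"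
  proof -
    have "(\<integral>x. (\<integral>y. ln (norm (x - y)) * u y \<partial>?M) * w x \<partial>?M) = (\<integral>x. - (2 * pi * \<tau>) * (u x * w x) \<partial>?M)"
    proof (rule integral_cong_AE)
      show "AE x in ?M. (\<integral>y. ln (norm (x - y)) * u y \<partial>?M) * w x = - (2 * pi * \<tau>) * (u x * w x)"
        using ueig by eventually_elim simp
    qed measurable
    moreover have "(\<integral>x. (\<integral>y. ln (norm (x - y)) * w y \<partial>?M) * u x \<partial>?M) = (\<integral>x. - (2 * pi * \<sigma>) * (u x * w x) \<partial>?M)"
    proof (rule integral_cong_AE)
      show "AE x in ?M. (\<integral>y. ln (norm (x - y)) * w y \<partial>?M) * u x = - (2 * pi * \<sigma>) * (u x * w x)"
        using weig by eventually_elim simp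
    qed measurable
    ultimately show ?thesis
      using ln_form_eq[OF R usq wsq] by (simp add: uw_def)
  qed
  have form: "p\<^sup>2 * \<tau> * uu + 2 * p * q * \<tau> * uw + q\<^sup>2 * \<sigma> * ww \<ge> 0" if pq: "p * a + q * b = 0" for p q
  proof -
    let ?v = "\<lambda>x. p * u x + q * w x"
    have vsq: "square_integrable ?M ?v" by (rule square_integrable_lincomb[OF usq wsq])
    have "(\<integral>x. ?v x \<partial>?M) = 0"
      using pq square_integrable_integrable[OF fM usq] square_integrable_integrable[OF fM wsq]
      by (simp add: a_def b_def)
    from ln_form_nonpos[OF R vsq this] have "(\<integral>x. (\<integral>y. ln (norm (x - y)) * ?v y \<partial>?M) * ?v x \<partial>?M) \<le> 0"
      unfolding ln_form_eq(1)[OF R vsq vsq] .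
    also have "(\<integral>x. (\<integral>y. ln (norm (x - y)) * ?v y \<partial>?M) * ?v x \<partial>?M)
        = (\<integral>x. - (2 * pi) * (p\<^sup>2 * \<tau> * (u x)\<^sup>2 + p * q * (\<tau> + \<sigma>) * (u x * w x) + q\<^sup>2 * \<sigma> * (w x)\<^sup>2) \<partial>?M)"
    proof (rule integral_cong_AE)
      show "AE x in ?M. (\<integral>y. ln (norm (x - y)) * ?v y \<partial>?M) * ?v x
          = - (2 * pi) * (p\<^sup>2 * \<tau> * (u x)\<^sup>2 + p * q * (\<tau> + \<sigma>) * (u x * w x) + q\<^sup>2 * \<sigma> * (w x)\<^sup>2)"
        using ueig weig AE_disc
      proof eventually_elim
        case (elim x)
        have x: "x \<in> ball 0 R" using elim by simp
        have "(\<integral>y. ln (norm (x - y)) * ?v y \<partial>?M) = (\<integral>y. p * (ln (norm (x - y)) * u y) + q * (ln (norm (x - y)) * w y) \<partial>?M)"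
          by (intro Bochner_Integration.integral_cong) (auto simp: algebra_simps)
        also have "\<dots> = p * (- (2 * pi * \<tau>) * u x) + q * (- (2 * pi * \<sigma>) * w x)"
          using ln_kernel_integrable(2)[OF R usq usq x] ln_kernel_integrable(2)[OF R wsq wsq x] elim by simp
        finally have eq: "(\<integral>y. ln (norm (x - y)) * ?v y \<partial>?M) = p * (- (2 * pi * \<tau>) * u x) + q * (- (2 * pi * \<sigma>) * w x)" .
        show ?case unfolding eq by (simp add: power2_eq_square algebra_simps)
      qed
    qed measurable
    also have "\<dots> = - (2 * pi) * (p\<^sup>2 * \<tau> * uu + p * q * (\<tau> + \<sigma>) * uw + q\<^sup>2 * \<sigma> * ww)"
      using iuu iuw iww by (simp add: uu_def uw_def ww_def)
    finally have "p\<^sup>2 * \<tau> * uu + p * q * (\<tau> + \<sigma>) * uw + q\<^sup>2 * \<sigma> * ww \<ge> 0"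
      using pi_gt_zero by (auto simp: mult_le_0_iff zero_le_mult_iff)
    moreover have "p * q * (\<tau> + \<sigma>) * uw = 2 * p * q * \<tau> * uw"
      using sym by auto
    ultimately show ?thesis by simp
  qed
  \<comment> \<open>A mean-zero \<open>w\<close> would itself contradict the sign of the form.\<close>
  have b0: "b \<noteq> 0"
  proof
    assume "b = 0"
    then have "\<sigma> * ww \<ge> 0" using form[of 0 1] by simp
    then show False using \<sigma> pos(2) by (simp add: zero_le_mult_iff)
  qed
  have main: "b\<^sup>2 * \<tau> * uu + 2 * b * (- a) * \<tau> * uw + (- a)\<^sup>2 * \<sigma> * ww \<ge> 0"
    by (rule form) simp
  have eq: "\<tau> = \<sigma>"
  proof (rule ccontr)
    assume "\<tau> \<noteq> \<sigma>"
    then have "uw = 0" using sym by simp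
    moreover have "b\<^sup>2 * \<tau> * uu < 0" using b0 \<tau> pos by (simp add: mult_neg_pos mult_pos_neg)
    moreover have "a\<^sup>2 * \<sigma> * ww \<le> 0" using \<sigma> pos by (simp add: mult_le_0_iff)
    ultimately show False using main by simp
  qed
  let ?v = "\<lambda>x. b * u x + - a * w x"
  have iv: "integrable ?M (\<lambda>x. (?v x)\<^sup>2)"
    using square_integrable_lincomb[OF usq wsq, of b "- a"] by (simp add: square_integrable_def)
  have "(\<integral>x. (?v x)\<^sup>2 \<partial>?M) = (\<integral>x. b\<^sup>2 * (u x)\<^sup>2 + 2 * b * (- a) * (u x * w x) + (- a)\<^sup>2 * (w x)\<^sup>2 \<partial>?M)"
    by (intro Bochner_Integration.integral_cong) (auto simp: power2_eq_square algebra_simps)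
  also have "\<dots> = b\<^sup>2 * uu + 2 * b * (- a) * uw + (- a)\<^sup>2 * ww"
    using iuu iuw iww by (simp add: uu_def uw_def ww_def)
  finally have v2: "(\<integral>x. (?v x)\<^sup>2 \<partial>?M) = b\<^sup>2 * uu + 2 * b * (- a) * uw + (- a)\<^sup>2 * ww" .
  have "\<tau> * (\<integral>x. (?v x)\<^sup>2 \<partial>?M) \<ge> 0" unfolding v2 using main eq by (simp add: algebra_simps)
  then have "(\<integral>x. (?v x)\<^sup>2 \<partial>?M) \<le> 0" using \<tau> by (simp add: zero_le_mult_iff)
  then have "(\<integral>x. (?v x)\<^sup>2 \<partial>?M) = 0" by (intro antisym Bochner_Integration.integral_nonneg) auto
  then have "AE x in ?M. (?v x)\<^sup>2 = 0" using integral_nonneg_eq_0_iff_AE[OF iv] by simp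
  then have "AE x in ?M. u x = a / b * w x" by eventually_elim (use b0 in \<open>simp add: field_simps\<close>)
  then show ?thesis using eq by blast
qed

lemma robin_J: "robin R (- (\<mu>\<^sup>2)) = J_boundary R (\<mu> * R)"
  using bess_scale[of "-1" \<mu> R] by (simp add: robin_def J_boundary_eq)

lemma robin_I: "robin R (\<mu>\<^sup>2) = I_boundary R (\<mu> * R)"
  using bess_scale[of 1 \<mu> R] by (simp add: robin_def I_boundary_eq)

theorem theoremA2:
  fixes R :: real
  assumes "R > 0"
  shows "(\<forall>n\<ge>1. \<exists>!t. is_nth_pos_zero (J_boundary R) n t) \<and>
    {\<tau>. 0 < \<tau> \<and> radial_eigenvalue R \<tau>} = {R\<^sup>2 / (mu_rad R n)\<^sup>2 | n. n \<ge> 1} \<and>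
    (\<forall>n\<ge>1. \<forall>u. radial_eigenfunction R (R\<^sup>2 / (mu_rad R n)\<^sup>2) u \<longleftrightarrow>
        (\<exists>c. c \<noteq> 0 \<and> (AE x in lebesgue_on (ball 0 R). u x = c * bessel_J0 (mu_rad R n / R * norm x)))) \<and>
    (R > 1 \<longrightarrow>
      (\<exists>!t. 0 < t \<and> I_boundary R t = 0) \<and>
      (\<exists>!\<tau>. \<tau> < 0 \<and> eigenvalue (ball 0 R) \<tau>) \<and>
      - (R\<^sup>2 / (mu_neg R)\<^sup>2) < 0 \<and> eigenvalue (ball 0 R) (- (R\<^sup>2 / (mu_neg R)\<^sup>2)) \<and>
      (\<forall>u. eigenfunction (ball 0 R) (- (R\<^sup>2 / (mu_neg R)\<^sup>2)) u \<longleftrightarrow>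
        (\<exists>c. c \<noteq> 0 \<and> (AE x in lebesgue_on (ball 0 R). u x = c * bessel_I0 (mu_neg R / R * norm x)))))"
proof (intro conjI)
  show "\<forall>n\<ge>1. \<exists>!t. is_nth_pos_zero (J_boundary R) n t" using J_boundary_nth_zero by blast
  have mu: "mu_rad R n > 0" "J_boundary R (mu_rad R n) = 0" if "n \<ge> 1" for n
    using mu_rad_zeros[of R] that by auto
  have inv: "- 1 / (R\<^sup>2 / \<mu>\<^sup>2) = - ((\<mu> / R)\<^sup>2)" if "\<mu> > 0" for \<mu>
    by (simp add: power_divide)
  have robin_mu: "robin R (- 1 / (R\<^sup>2 / \<mu>\<^sup>2)) = J_boundary R \<mu>" if "\<mu> > 0" for \<mu>
    unfolding inv[OF that] robin_J using assms by simp
  show "{\<tau>. 0 < \<tau> \<and> radial_eigenvalue R \<tau>} = {R\<^sup>2 / (mu_rad R n)\<^sup>2 | n. n \<ge> 1}"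
  proof (intro equalityI subsetI)
    fix \<tau> assume "\<tau> \<in> {\<tau>. 0 < \<tau> \<and> radial_eigenvalue R \<tau>}"
    then have \<tau>: "0 < \<tau>" "robin R (- 1 / \<tau>) = 0" using radial_eigenvalue_iff[OF assms, of \<tau>] by auto
    define \<mu> where "\<mu> = R / sqrt \<tau>"
    have \<mu>: "\<mu> > 0" "\<tau> = R\<^sup>2 / \<mu>\<^sup>2" using \<tau> assms by (auto simp: \<mu>_def power_divide)
    then have "\<mu> \<in> mu_rad R ` {1..}" using \<tau>(2) robin_mu[OF \<mu>(1)] mu_rad_zeros[of R] by simp
    then show "\<tau> \<in> {R\<^sup>2 / (mu_rad R n)\<^sup>2 | n. n \<ge> 1}" using \<mu>(2) by auto
  next
    fix \<tau> assume "\<tau> \<in> {R\<^sup>2 / (mu_rad R n)\<^sup>2 | n. n \<ge> 1}"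
    then obtain n where n: "n \<ge> 1" "\<tau> = R\<^sup>2 / (mu_rad R n)\<^sup>2" by auto
    have \<tau>: "\<tau> > 0" using mu(1)[OF n(1)] assms n(2) by simp
    have "robin R (- 1 / \<tau>) = 0" using robin_mu[OF mu(1)[OF n(1)]] mu(2)[OF n(1)] n(2) by simp
    then show "\<tau> \<in> {\<tau>. 0 < \<tau> \<and> radial_eigenvalue R \<tau>}"
      using \<tau> radial_eigenvalue_iff[OF assms, of \<tau>] by simp
  qed
  show "\<forall>n\<ge>1. \<forall>u. radial_eigenfunction R (R\<^sup>2 / (mu_rad R n)\<^sup>2) u \<longleftrightarrow>
        (\<exists>c. c \<noteq> 0 \<and> (AE x in lebesgue_on (ball 0 R). u x = c * bessel_J0 (mu_rad R n / R * norm x)))"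
  proof (intro allI impI)
    fix n :: nat and u assume n: "n \<ge> 1"
    have nz: "R\<^sup>2 / (mu_rad R n)\<^sup>2 \<noteq> 0" using mu(1)[OF n] assms by simp
    have "bess (- 1 / (R\<^sup>2 / (mu_rad R n)\<^sup>2)) s = bessel_J0 (mu_rad R n / R * s)" for s
      unfolding inv[OF mu(1)[OF n]] bessel_J0_eq_bess using bess_scale(1)[of "-1" "mu_rad R n / R" s] by simp
    then show "radial_eigenfunction R (R\<^sup>2 / (mu_rad R n)\<^sup>2) u \<longleftrightarrow>
        (\<exists>c. c \<noteq> 0 \<and> (AE x in lebesgue_on (ball 0 R). u x = c * bessel_J0 (mu_rad R n / R * norm x)))"
      unfolding radial_eigenfunction_iff[OF assms nz] robin_mu[OF mu(1)[OF n]] using mu(2)[OF n] by simp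
  qed
  show "R > 1 \<longrightarrow>
      (\<exists>!t. 0 < t \<and> I_boundary R t = 0) \<and>
      (\<exists>!\<tau>. \<tau> < 0 \<and> eigenvalue (ball 0 R) \<tau>) \<and>
      - (R\<^sup>2 / (mu_neg R)\<^sup>2) < 0 \<and> eigenvalue (ball 0 R) (- (R\<^sup>2 / (mu_neg R)\<^sup>2)) \<and>
      (\<forall>u. eigenfunction (ball 0 R) (- (R\<^sup>2 / (mu_neg R)\<^sup>2)) u \<longleftrightarrow>
        (\<exists>c. c \<noteq> 0 \<and> (AE x in lebesgue_on (ball 0 R). u x = c * bessel_I0 (mu_neg R / R * norm x))))"
  proof
    assume R1: "R > 1"
    define \<mu> where "\<mu> = mu_neg R"
    define \<sigma> where "\<sigma> = - (R\<^sup>2 / \<mu>\<^sup>2)"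
    define w where "w = (\<lambda>x::real^2. bessel_I0 (\<mu> / R * norm x))"
    have \<mu>: "\<mu> > 0" "I_boundary R \<mu> = 0"
      using theI'[OF I_boundary_unique_zero[OF R1]] unfolding \<mu>_def mu_neg_def by auto
    have \<sigma>: "\<sigma> < 0" using \<mu> assms by (simp add: \<sigma>_def)
    have inv\<sigma>: "- 1 / \<sigma> = (\<mu> / R)\<^sup>2" by (simp add: \<sigma>_def power_divide)
    have bess_w: "bess (- 1 / \<sigma>) (norm x) = w x" for x :: "real^2"
      unfolding inv\<sigma> w_def bessel_I0_eq_bess using bess_scale(1)[of 1 "\<mu> / R" "norm x"] by simp
    have robin0: "robin R (- 1 / \<sigma>) = 0"
      unfolding inv\<sigma> robin_I using \<mu> assms by simp
    have radial: "radial_eigenfunction R \<sigma> u \<longleftrightarrow>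
        (\<exists>c. c \<noteq> 0 \<and> (AE x in lebesgue_on (ball 0 R). u x = c * w x))" for u
      using radial_eigenfunction_iff[OF assms, of \<sigma> u] \<sigma> robin0 unfolding bess_w by simp
    have w: "eigenfunction (ball 0 R) \<sigma> w"
    proof -
      have "radial_eigenfunction R \<sigma> w" unfolding radial by (intro exI[of _ 1]) simp
      then show ?thesis by (simp add: radial_eigenfunction_def)
    qed
    have uniq: "\<tau> = \<sigma> \<and> (\<exists>c. AE x in lebesgue_on (ball 0 R). u x = c * w x)"
      if "\<tau> < 0" "eigenfunction (ball 0 R) \<tau> u" for \<tau> u
      by (rule negative_eigenfunctions_proportional[OF assms \<sigma> that(1) w that(2)])
    have eig_iff: "eigenfunction (ball 0 R) \<sigma> u \<longleftrightarrow>
        (\<exists>c. c \<noteq> 0 \<and> (AE x in lebesgue_on (ball 0 R). u x = c * w x))" for u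
    proof
      assume u: "eigenfunction (ball 0 R) \<sigma> u"
      obtain c where c: "AE x in lebesgue_on (ball 0 R). u x = c * w x" using uniq[OF \<sigma> u] by blast
      moreover have "c \<noteq> 0" using c u by (auto simp: eigenfunction_def)
      ultimately show "\<exists>c. c \<noteq> 0 \<and> (AE x in lebesgue_on (ball 0 R). u x = c * w x)" by blast
    qed (use radial in \<open>auto simp: radial_eigenfunction_def\<close>)
    have ev: "eigenvalue (ball 0 R) \<sigma>" using w by (auto simp: eigenvalue_def)
    have "\<exists>!\<tau>. \<tau> < 0 \<and> eigenvalue (ball 0 R) \<tau>"
      using \<sigma> ev uniq by (auto simp: eigenvalue_def)
    then show "(\<exists>!t. 0 < t \<and> I_boundary R t = 0) \<and>
      (\<exists>!\<tau>. \<tau> < 0 \<and> eigenvalue (ball 0 R) \<tau>) \<and>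
      - (R\<^sup>2 / (mu_neg R)\<^sup>2) < 0 \<and> eigenvalue (ball 0 R) (- (R\<^sup>2 / (mu_neg R)\<^sup>2)) \<and>
      (\<forall>u. eigenfunction (ball 0 R) (- (R\<^sup>2 / (mu_neg R)\<^sup>2)) u \<longleftrightarrow>
        (\<exists>c. c \<noteq> 0 \<and> (AE x in lebesgue_on (ball 0 R). u x = c * bessel_I0 (mu_neg R / R * norm x))))"
      using I_boundary_unique_zero[OF R1] ev \<sigma> eig_iff unfolding \<sigma>_def \<mu>_def w_def by blast
  qed
qed

end
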